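(* Let $\mathcal Q$ be as in the context (block off-diagonal with $L^1(\mathbb R)$ entries). Then there exist $n\times n$ matrix functions $K(x,y)$, defined for $y\ge x$, and $J(x,y)$, defined for $y\le x$, such that for all $x,k\in\mathbb R$ \begin{align*} M(x,k)e_+&=e_++\int_x^\infty e^{ik(y-x)}K(x,y)e_+\,dy,& M(x,k)e_-&=e_-+\int_x^\infty e^{-ik(y-x)}K(x,y)e_-\,dy,\\ N(x,k)e_+&=e_++\int_{-\infty}^x e^{-ik(x-y)}J(x,y)e_+\,dy,& N(x,k)e_-&=e_-+\int_{-\infty}^x e^{ik(x-y)}J(x,y)e_-\,dy, \end{align*} and the quantities $$\int_x^\infty\|K(x,y)e_+\|\,dy+\int_{-\infty}^x\|J(x,y)e_+\|\,dy,\qquad \int_x^\infty\|K(x,y)e_-\|\,dy+\int_{-\infty}^x\|J(x,y)e_-\|\,dy$$ are finite and bounded uniformly in $x\in\mathbb R$.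
   Context: Let $m_+,m_-\ge1$ be integers, $n=m_++m_-+1$, and $\Sigma=\mathrm{diag}(I_{m_+},0,-I_{m_-})$, the $n\times n$ diagonal matrix with $m_+$ entries $1$, the entry $0$ in position $m_++1$, and $m_-$ entries $-1$. All $n\times n$ matrices are partitioned into blocks with respect to $n=m_++1+m_-$, with block indices $+,0,-$. The potential is an $n\times n$ matrix function $\mathcal Q(x)=\begin{bmatrix}0_{m_+\times m_+}&q_{+0}(x)&q_{+-}(x)\\ q_{0+}(x)&0&q_{0-}(x)\\ q_{-+}(x)&q_{-0}(x)&0_{m_-\times m_-}\end{bmatrix}$, $x\in\mathbb R$, whose entries belong to $L^1(\mathbb R)$. The AKNS system is $v_x=(ik\Sigma+\mathcal Q(x))v$. Let $e_+=\begin{bmatrix}I_{m_+}\\ 0_{(1+m_-)\times m_+}\end{bmatrix}$, let $e_0$ be the $(m_++1)$-st standard basis column of $\mathbb C^n$, and $e_-=\begin{bmatrix}0_{(m_++1)\times m_-}\\ I_{m_-}\end{bmatrix}$. For $k\in\mathbb R$ the Jost matrices $\Psi(x,k),\Phi(x,k)$ are the unique continuous $n\times n$ solutions of the Volterra equations $\Psi(x,k)=e^{ikx\Sigma}-\int_x^\infty e^{-ik(y-x)\Sigma}\mathcal Q(y)\Psi(y,k)\,dy$ and $\Phi(x,k)=e^{ikx\Sigma}+\int_{-\infty}^x e^{ik(x-y)\Sigma}\mathcal Q(y)\Phi(y,k)\,dy$; they solve the AKNS system with $\Psi(x,k)=e^{ikx\Sigma}[I_n+o(1)]$ as $x\to+\infty$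 and $\Phi(x,k)=e^{ikx\Sigma}[I_n+o(1)]$ as $x\to-\infty$. The Faddeev matrices are $M(x,k)=\Psi(x,k)e^{-ikx\Sigma}$ and $N(x,k)=\Phi(x,k)e^{-ikx\Sigma}$. *)

theory Defs
  imports "HOL-Analysis.Analysis"
begin

text \<open>n x n complex matrices are represented as functions nat => nat => complex,
  only indices below n = mp + mm + 1 being relevant. Block '+' = indices 0..<mp,
  block '0' = index mp, block '-' = indices mp+1..<n.\<close>

definition dimn :: "nat \<Rightarrow> nat \<Rightarrow> nat" where
  "dimn mp mm = mp + mm + 1"

text \<open>Diagonal entries of Sigma = diag(I_{m+}, 0, -I_{m-}).\<close>
definition sig :: "nat \<Rightarrow> nat \<Rightarrow> real" where
  "sig mp i = (if i < mp then 1 else if i = mp then 0 else -1)"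

definition idm :: "nat \<Rightarrow> nat \<Rightarrow> complex" where
  "idm i j = (if i = j then 1 else 0)"

definition admissible_pot :: "nat \<Rightarrow> nat \<Rightarrow> (real \<Rightarrow> nat \<Rightarrow> nat \<Rightarrow> complex) \<Rightarrow> bool" where
  "admissible_pot mp mm Q \<longleftrightarrow>
     (\<forall>i<dimn mp mm. \<forall>j<dimn mp mm. integrable lborel (\<lambda>x. Q x i j)) \<and>
     (\<forall>x i j. (i < mp \<and> j < mp) \<longrightarrow> Q x i j = 0) \<and>
     (\<forall>x. Q x mp mp = 0) \<and>
     (\<forall>x i j. (mp < i \<and> i < dimn mp mm \<and> mp < j \<and> j < dimn mp mm) \<longrightarrow> Q x i j = 0)"

definition is_jost_psi :: "nat \<Rightarrow> nat \<Rightarrow> (real \<Rightarrow> nat \<Rightarrow> nat \<Rightarrow> complex)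
    \<Rightarrow> (real \<Rightarrow> real \<Rightarrow> nat \<Rightarrow> nat \<Rightarrow> complex) \<Rightarrow> bool" where
  "is_jost_psi mp mm Q Psi \<longleftrightarrow>
    (\<forall>x k i j. \<not> (i < dimn mp mm \<and> j < dimn mp mm) \<longrightarrow> Psi x k i j = 0) \<and>
    (\<forall>k. \<forall>i<dimn mp mm. \<forall>j<dimn mp mm.
       continuous_on UNIV (\<lambda>x. Psi x k i j) \<and>
       (\<forall>x. set_integrable lborel {x..}
              (\<lambda>y. exp (- \<i> * of_real (k * (y - x) * sig mp i)) *
                    (\<Sum>l<dimn mp mm. Q y i l * Psi y k l j)) \<and>
            Psi x k i j = idm i j * exp (\<i> * of_real (k * x * sig mp i))
              - (LINT y:{x..}|lborel. exp (- \<i> * of_real (k * (y - x) * sig mp i)) *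
                    (\<Sum>l<dimn mp mm. Q y i l * Psi y k l j))))"

definition is_jost_phi :: "nat \<Rightarrow> nat \<Rightarrow> (real \<Rightarrow> nat \<Rightarrow> nat \<Rightarrow> complex)
    \<Rightarrow> (real \<Rightarrow> real \<Rightarrow> nat \<Rightarrow> nat \<Rightarrow> complex) \<Rightarrow> bool" where
  "is_jost_phi mp mm Q Phi \<longleftrightarrow>
    (\<forall>x k i j. \<not> (i < dimn mp mm \<and> j < dimn mp mm) \<longrightarrow> Phi x k i j = 0) \<and>
    (\<forall>k. \<forall>i<dimn mp mm. \<forall>j<dimn mp mm.
       continuous_on UNIV (\<lambda>x. Phi x k i j) \<and>
       (\<forall>x. set_integrable lborel {..x}
              (\<lambda>y. exp (\<i> * of_real (k * (x - y) * sig mp i)) *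
                    (\<Sum>l<dimn mp mm. Q y i l * Phi y k l j)) \<and>
            Phi x k i j = idm i j * exp (\<i> * of_real (k * x * sig mp i))
              + (LINT y:{..x}|lborel. exp (\<i> * of_real (k * (x - y) * sig mp i)) *
                    (\<Sum>l<dimn mp mm. Q y i l * Phi y k l j))))"

definition jost_psi where "jost_psi mp mm Q = (THE Psi. is_jost_psi mp mm Q Psi)"
definition jost_phi where "jost_phi mp mm Q = (THE Phi. is_jost_phi mp mm Q Phi)"

definition faddeev_M :: "nat \<Rightarrow> nat \<Rightarrow> (real \<Rightarrow> nat \<Rightarrow> nat \<Rightarrow> complex) \<Rightarrow> real \<Rightarrow> real \<Rightarrow> nat \<Rightarrow> nat \<Rightarrow> complex" where
  "faddeev_M mp mm Q x k i j = jost_psi mp mm Q x k i j * exp (- \<i> * of_real (k * x * sig mp j))"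
definition faddeev_N :: "nat \<Rightarrow> nat \<Rightarrow> (real \<Rightarrow> nat \<Rightarrow> nat \<Rightarrow> complex) \<Rightarrow> real \<Rightarrow> real \<Rightarrow> nat \<Rightarrow> nat \<Rightarrow> complex" where
  "faddeev_N mp mm Q x k i j = jost_phi mp mm Q x k i j * exp (- \<i> * of_real (k * x * sig mp j))"

definition plus_cols :: "nat \<Rightarrow> nat set" where "plus_cols mp = {0..<mp}"
definition minus_cols :: "nat \<Rightarrow> nat \<Rightarrow> nat set" where "minus_cols mp mm = {mp+1..<dimn mp mm}"

definition colnorm :: "nat \<Rightarrow> nat set \<Rightarrow> (nat \<Rightarrow> nat \<Rightarrow> complex) \<Rightarrow> real" where
  "colnorm n C A = sqrt (\<Sum>i<n. \<Sum>j\<in>C. (cmod (A i j))\<^sup>2)"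

end

theory Submission
  imports Defs
begin

text \<open>
  Fix a column \<open>j\<close> and put \<open>d\<^sub>i = s\<^sub>j - s\<^sub>i\<close>, where the \<open>s\<^sub>i\<close> are the diagonal entries of \<open>\<Sigma>\<close>.
  The \<open>j\<close>-th column \<open>m\<close> of the Faddeev matrix solves
  \<open>m\<^sub>i(x) = \<delta>\<^sub>i\<^sub>j - \<integral>\<^sub>x\<^sup>\<infinity> e\<^bsup>ikd\<^sub>i(y-x)\<^esup> \<Sum>\<^sub>l Q\<^sub>i\<^sub>l(y) m\<^sub>l(y) dy\<close>.
  Each Picard iterate is the Fourier transform, in the dual variable \<open>t\<close> of \<open>k\<close>, of an integrable kernel:
  for the first one substitute \<open>t = d\<^sub>i(y - x)\<close>, which is possible because \<open>Q\<^sub>i\<^sub>j = 0\<close> whenever \<open>d\<^sub>i = 0\<close>,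
  and the later ones arise by translating the previous kernel by \<open>d\<^sub>i(y - x)\<close> and averaging.
  The \<open>L\<^sup>1\<close> norm of the \<open>p\<close>-th kernel is at most \<open>\<parallel>Q\<parallel>\<^bsup>p+1\<^esup> / (p+1)!\<close>, so the kernels sum up in \<open>L\<^sup>1\<close>.
  All \<open>d\<^sub>i\<close> are nonnegative in a plus column and nonpositive in a minus column, so there the sum is
  supported on a half-line. The functions \<open>\<Phi>\<close> are reduced to \<open>\<Psi>\<close> by
  \<open>x \<mapsto> -x\<close>, \<open>k \<mapsto> -k\<close>.
\<close>

section \<open>Iterated tail integrals\<close>

text \<open>Integral of \<open>q y1 * ... * q yp\<close> over the ordered simplex x \<le> y1 \<le>
  ... \<le> yp. Values in \<open>ennreal\<close> let Tonelli's theorem apply without integrability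
  conditions.\<close>

primrec tail_iter :: "(real \<Rightarrow> ennreal) \<Rightarrow> nat \<Rightarrow> real \<Rightarrow> ennreal" where
  "tail_iter q 0 = (\<lambda>x. 1)"
| "tail_iter q (Suc p) = (\<lambda>x. \<integral>\<^sup>+y. q y * tail_iter q p y * indicator {x..} y \<partial>lborel)"

lemma measurable_tail_iter [measurable]:
  assumes [measurable]: "q \<in> borel_measurable borel"
  shows "tail_iter q p \<in> borel_measurable borel"
proof (induction p)
  case (Suc p)
  note [measurable] = Suc
  show ?case
    unfolding tail_iter.simps indicator_def atLeast_iff by measurable
qed simp

text \<open>
  The step splits \<open>\<integral>\<^sub>x\<^sup>\<infinity> q = \<integral>\<^sub>x\<^sup>z q + \<integral>\<^sub>z\<^sup>\<infinity> q\<close> below the outer integral in \<open>z\<close> and exchanges the order of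
  integration in the first part, so that no differentiation of the tail integral is needed.
\<close>
lemma tail_iter_Suc_mult:
  assumes [measurable]: "q \<in> borel_measurable borel"
  shows "of_nat (Suc p) * tail_iter q (Suc p) x = tail_iter q 1 x * tail_iter q p x"
proof (induction p arbitrary: x)
  case (Suc p)
  let ?T = "tail_iter q p" and ?W = "tail_iter q 1"
  have W: "?W x = (\<integral>\<^sup>+y. q y * indicator {x..} y \<partial>lborel)" for x by simp
  have split: "?W x = ?W z + (\<integral>\<^sup>+y. q y * indicator {x..<z} y \<partial>lborel)" if "x \<le> z" for z
    unfolding W using that
    by (subst nn_integral_add[symmetric]) (auto intro!: nn_integral_cong split: split_indicator)
  \<comment> \<open>The factor p + 1 is moved under the outer integral, where the induction
    hypothesis applies at the point z.\<close>
  have 1: "of_nat (Suc p) * tail_iter q (Suc (Suc p)) x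
      = (\<integral>\<^sup>+z. q z * ?T z * ?W z * indicator {x..} z \<partial>lborel)"
  proof -
    have "of_nat (Suc p) * tail_iter q (Suc (Suc p)) x
      = (\<integral>\<^sup>+z. of_nat (Suc p) * (q z * tail_iter q (Suc p) z * indicator {x..} z) \<partial>lborel)"
      by (subst nn_integral_cmult) (simp_all del: tail_iter.simps(2) add: tail_iter.simps(2)[of q "Suc p"])
    also have "\<dots> = (\<integral>\<^sup>+z. q z * (of_nat (Suc p) * tail_iter q (Suc p) z) * indicator {x..} z \<partial>lborel)"
      by (simp only: mult_ac)
    also have "\<dots> = (\<integral>\<^sup>+z. q z * ?T z * ?W z * indicator {x..} z \<partial>lborel)"
      by (simp only: Suc mult_ac)
    finally show ?thesis .
  qed
  have "tail_iter q (Suc (Suc p)) x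
      = (\<integral>\<^sup>+y. (\<integral>\<^sup>+z. q y * q z * ?T z * indicator {x..} y * indicator {y..} z \<partial>lborel) \<partial>lborel)"
    by (auto simp: nn_integral_cmult[symmetric] mult_ac intro!: nn_integral_cong split: split_indicator)
  also have "\<dots> = (\<integral>\<^sup>+z. (\<integral>\<^sup>+y. q y * q z * ?T z * indicator {x..} y * indicator {y..} z \<partial>lborel) \<partial>lborel)"
    unfolding indicator_def atLeast_iff by (rule lborel_pair.Fubini') measurable
  also have "\<dots> = (\<integral>\<^sup>+z. (\<integral>\<^sup>+y. q z * ?T z * indicator {x..} z * (q y * indicator {x..<z} y) \<partial>lborel) \<partial>lborel)"
  \<comment> \<open>The two indicators differ only on the null set y = z. The half-open interval
    makes the decomposition behind \<open>split\<close> exact at every point.\<close>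
  proof (rule nn_integral_cong, rule nn_integral_cong_AE)
    fix z :: real
    show "AE y in lborel. q y * q z * ?T z * indicator {x..} y * indicator {y..} z
        = q z * ?T z * indicator {x..} z * (q y * indicator {x..<z} y)"
      using AE_lborel_singleton[of z]
      by eventually_elim (auto simp: mult_ac split: split_indicator)
  qed
  also have "\<dots> = (\<integral>\<^sup>+z. q z * ?T z * indicator {x..} z * (\<integral>\<^sup>+y. q y * indicator {x..<z} y \<partial>lborel) \<partial>lborel)"
    by (simp add: nn_integral_cmult)
  finally have 2: "tail_iter q (Suc (Suc p)) x = \<dots>" .
  have [measurable]: "(\<lambda>z. \<integral>\<^sup>+y. q y * indicator {x..<z} y \<partial>lborel) \<in> borel_measurable borel"
    unfolding indicator_def atLeastLessThan_iff by measurable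
  have "of_nat (Suc (Suc p)) * tail_iter q (Suc (Suc p)) x
      = of_nat (Suc p) * tail_iter q (Suc (Suc p)) x + tail_iter q (Suc (Suc p)) x"
    by (simp only: of_nat_Suc[of "Suc p"] distrib_right mult_1 add.commute)
  also have "\<dots> = (\<integral>\<^sup>+z. q z * ?T z * ?W z * indicator {x..} z +
      q z * ?T z * indicator {x..} z * (\<integral>\<^sup>+y. q y * indicator {x..<z} y \<partial>lborel) \<partial>lborel)"
    by (subst (2) 2, subst 1, rule nn_integral_add[symmetric]) measurable
  also have "\<dots> = (\<integral>\<^sup>+z. ?W x * (q z * ?T z * indicator {x..} z) \<partial>lborel)"
  proof (rule nn_integral_cong)
    fix z
    show "q z * ?T z * ?W z * indicator {x..} z +
      q z * ?T z * indicator {x..} z * (\<integral>\<^sup>+y. q y * indicator {x..<z} y \<partial>lborel)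
      = ?W x * (q z * ?T z * indicator {x..} z)"
    proof (cases "x \<le> z")
      case True
      show ?thesis unfolding split[OF True] distrib_left distrib_right by (simp only: mult_ac)
    qed simp
  qed
  also have "\<dots> = ?W x * tail_iter q (Suc p) x"
    by (subst nn_integral_cmult) simp_all
  finally show ?case .
qed simp

text \<open>The ordered simplex fills the fraction 1/p! of the cube; formally,
  \<open>tail_iter_Suc_mult\<close> is iterated. The factorial stays on the left to avoid division
  in \<open>ennreal\<close>.\<close>

lemma fact_mult_tail_iter:
  assumes "q \<in> borel_measurable borel"
  shows "of_nat (fact p) * tail_iter q p x = tail_iter q 1 x ^ p"
proof (induction p)
  case (Suc p)
  have "of_nat (fact (Suc p)) * tail_iter q (Suc p) x
      = of_nat (fact p) * (of_nat (Suc p) * tail_iter q (Suc p) x)"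
    by (simp only: fact_Suc of_nat_mult mult_ac of_nat_id)
  also have "\<dots> = tail_iter q 1 x ^ Suc p"
    unfolding tail_iter_Suc_mult[OF assms] Suc[symmetric] power_Suc by (simp only: mult_ac)
  finally show ?case .
qed simp

lemma tail_iter_le:
  assumes [measurable]: "q \<in> borel_measurable borel"
    and C: "(\<integral>\<^sup>+y. q y \<partial>lborel) \<le> ennreal C" and "0 \<le> C"
  shows "tail_iter q p x \<le> ennreal (C ^ p / fact p)"
proof -
  have "tail_iter q 1 x \<le> (\<integral>\<^sup>+y. q y \<partial>lborel)"
    by (auto intro!: nn_integral_mono split: split_indicator)
  with C have "tail_iter q 1 x \<le> ennreal C" by (rule order_trans[rotated])
  hence "tail_iter q 1 x ^ p \<le> ennreal (C ^ p)"
    using \<open>0 \<le> C\<close> by (metis ennreal_power power_mono zero_le)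
  hence le: "of_nat (fact p) * tail_iter q p x \<le> ennreal (C ^ p)"
    by (simp only: fact_mult_tail_iter[OF assms(1)])
  have "ennreal (1 / fact p) * of_nat (fact p) = 1"
    unfolding ennreal_of_nat_eq_real_of_nat by (simp add: ennreal_mult[symmetric])
  hence "tail_iter q p x = ennreal (1 / fact p) * (of_nat (fact p) * tail_iter q p x)"
    by (simp only: mult.assoc[symmetric] mult_1)
  also have "\<dots> \<le> ennreal (1 / fact p) * ennreal (C ^ p)"
    by (rule mult_left_mono[OF le]) simp
  also have "\<dots> = ennreal (C ^ p / fact p)"
    using \<open>0 \<le> C\<close> by (simp add: ennreal_mult[symmetric])
  finally show ?thesis .
qed

section \<open>Kernels of the Picard iterates\<close>

text \<open>A Bochner integral that does not exist is 0 by convention, so no integrability is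
  assumed. This suits \<open>kap\<close>, whose defining integral is not known to exist at every
  t.\<close>

lemma norm_integral_le_nn_integral:
  fixes f :: "'a \<Rightarrow> 'b :: {banach, second_countable_topology}"
  shows "ennreal (norm (integral\<^sup>L M f)) \<le> (\<integral>\<^sup>+x. norm (f x) \<partial>M)"
  by (cases "integrable M f") (simp_all add: integral_norm_bound_ennreal not_integrable_integral_eq)

lemma nn_integral_lborel_shift:
  fixes c :: real
  assumes "f \<in> borel_measurable borel"
  shows "(\<integral>\<^sup>+t. f (t - c) \<partial>lborel) = (\<integral>\<^sup>+t. f t \<partial>lborel)"
  using nn_integral_real_affine[OF assms, of 1 "-c"] by simp

text \<open>A summable bound on the L1 norms permits termwise integration: by monotone convergence
  the sum of the norms has a finite integral, hence is finite almost everywhere.\<close>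

lemma integral_suminf_norm_bounds:
  fixes f :: "nat \<Rightarrow> 'a \<Rightarrow> 'b :: {banach, second_countable_topology}"
  assumes int: "\<And>p. integrable M (f p)"
    and le: "\<And>p. (\<integral>x. norm (f p x) \<partial>M) \<le> b p" and b: "summable b"
  shows "AE x in M. summable (\<lambda>p. norm (f p x))"
    and "integrable M (\<lambda>x. \<Sum>p. f p x)"
    and "(\<integral>x. (\<Sum>p. f p x) \<partial>M) = (\<Sum>p. \<integral>x. f p x \<partial>M)"
    and "summable (\<lambda>p. \<integral>x. f p x \<partial>M)"
    and "(\<integral>x. norm (\<Sum>p. f p x) \<partial>M) \<le> (\<Sum>p. b p)"
proof -
  have [measurable]: "f p \<in> borel_measurable M" for p using int by auto
  have s: "summable (\<lambda>p. \<integral>x. norm (f p x) \<partial>M)"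
    by (rule summable_comparison_test'[OF b, of 0]) (simp add: le)
  have "(\<integral>\<^sup>+x. (\<Sum>p. ennreal (norm (f p x))) \<partial>M) = (\<Sum>p. \<integral>\<^sup>+x. norm (f p x) \<partial>M)"
    by (rule nn_integral_suminf) measurable
  also have "\<dots> = (\<Sum>p. ennreal (\<integral>x. norm (f p x) \<partial>M))"
    using int by (simp add: nn_integral_eq_integral)
  also have "\<dots> = ennreal (\<Sum>p. \<integral>x. norm (f p x) \<partial>M)"
    by (rule suminf_ennreal2[OF _ s]) simp
  finally have eq: "(\<integral>\<^sup>+x. (\<Sum>p. ennreal (norm (f p x))) \<partial>M) = \<dots>" .
  have "AE x in M. (\<Sum>p. ennreal (norm (f p x))) \<noteq> \<infinity>"
    by (rule nn_integral_PInf_AE) (simp_all add: eq)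
  thus AE: "AE x in M. summable (\<lambda>p. norm (f p x))"
    by eventually_elim (auto intro!: summable_suminf_not_top)
  note * = integrable_suminf[OF int AE s] integral_suminf[OF int AE s] summable_integral[OF int AE s]
  show "integrable M (\<lambda>x. \<Sum>p. f p x)"
    "(\<integral>x. (\<Sum>p. f p x) \<partial>M) = (\<Sum>p. \<integral>x. f p x \<partial>M)"
    "summable (\<lambda>p. \<integral>x. f p x \<partial>M)" by fact+
  have "ennreal (\<integral>x. norm (\<Sum>p. f p x) \<partial>M) = (\<integral>\<^sup>+x. norm (\<Sum>p. f p x) \<partial>M)"
    using *(1) by (simp add: nn_integral_eq_integral)
  also have "\<dots> \<le> (\<integral>\<^sup>+x. (\<Sum>p. ennreal (norm (f p x))) \<partial>M)"
  proof (rule nn_integral_mono_AE)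
    show "AE x in M. ennreal (norm (\<Sum>p. f p x)) \<le> (\<Sum>p. ennreal (norm (f p x)))"
      using AE by eventually_elim (simp add: suminf_ennreal2 summable_norm suminf_nonneg)
  qed
  finally have "(\<integral>x. norm (\<Sum>p. f p x) \<partial>M) \<le> (\<Sum>p. \<integral>x. norm (f p x) \<partial>M)"
    unfolding eq by (subst (asm) ennreal_le_iff) (auto intro!: suminf_nonneg s)
  also have "\<dots> \<le> (\<Sum>p. b p)" by (rule suminf_le[OF le s b])
  finally show "(\<integral>x. norm (\<Sum>p. f p x) \<partial>M) \<le> (\<Sum>p. b p)" .
qed

text \<open>One column of the system in abstract form, with phase speeds \<open>d\<close>. The
  assumption \<open>nonresonant\<close> excludes a nonzero first Picard term that is constant in k;
  such a term would need a point mass at t = 0 instead of an integrable kernel.\<close>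

locale akns_column =
  fixes n j :: nat and d :: "nat \<Rightarrow> real" and A :: "real \<Rightarrow> nat \<Rightarrow> nat \<Rightarrow> complex"
  assumes integrable_A: "\<And>i l. integrable lborel (\<lambda>x. A x i l)"
    and j: "j < n"
    and nonresonant: "\<And>x i. d i = 0 \<Longrightarrow> A x i j = 0"
begin

lemma measurable_A [measurable (raw)]:
  assumes "f \<in> borel_measurable M"
  shows "(\<lambda>w. A (f w) i l) \<in> borel_measurable M"
  using measurable_compose[OF assms, of "\<lambda>x. A x i l" borel] integrable_A[of i l, THEN borel_measurable_integrable]
  by simp

text \<open>For \<open>d i = 0\<close> the first kernel is \<open>0\<close>, since division by \<open>0\<close> gives \<open>0\<close>.\<close>
primrec kap :: "nat \<Rightarrow> nat \<Rightarrow> real \<Rightarrow> real \<Rightarrow> complex" where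
  "kap 0 = (\<lambda>i x t. if 0 \<le> t / d i then - A (x + t / d i) i j / complex_of_real \<bar>d i\<bar> else 0)"
| "kap (Suc p) = (\<lambda>i x t. - (\<integral>y. (if x \<le> y then \<Sum>l<n. A y i l * kap p l y (t - d i * (y - x)) else 0) \<partial>lborel))"

lemma measurable_kap_pair: "(\<lambda>w. kap p i (fst w) (snd w)) \<in> borel_measurable (borel \<Otimes>\<^sub>M borel)"
proof (induction p arbitrary: i)
  case 0
  show ?case unfolding kap.simps by measurable
next
  case (Suc p)
  \<comment> \<open>The induction hypothesis is restated for arbitrary measurable arguments, so that
    it covers the shifted kernel inside the parametrized integral.\<close>
  have [measurable (raw)]: "(\<lambda>w. kap p i (f w) (g w)) \<in> borel_measurable M"
    if "f \<in> borel_measurable M" "g \<in> borel_measurable M" for f g i and M :: "((real \<times> real) \<times> real) measure"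
    using measurable_compose[OF measurable_Pair[OF that] Suc[of i]] by simp
  show ?case unfolding kap.simps by measurable
qed

lemma measurable_kap [measurable (raw)]:
  assumes "f \<in> borel_measurable M" "g \<in> borel_measurable M"
  shows "(\<lambda>w. kap p i (f w) (g w)) \<in> borel_measurable M"
  using measurable_compose[OF measurable_Pair[OF assms] measurable_kap_pair[of p i]] by simp

section \<open>Supports of the kernels\<close>

text \<open>The recursion evaluates the previous kernel at \<open>t - d i * (y - x)\<close>, which
  is at most \<open>t\<close> for x \<le> y, so the argument stays negative.\<close>

lemma kap_eq_0_of_neg:
  assumes "\<And>i. 0 \<le> d i" "t < 0"
  shows "kap p i x t = 0"
  using assms(2)
proof (induction p arbitrary: i x t)
  case 0
  thus ?case using assms(1)[of i] by (auto simp: divide_simps)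
next
  case (Suc p)
  have "kap p l y (t - d i * (y - x)) = 0" if "x \<le> y" for l y
    using that assms(1)[of i] Suc.prems by (intro Suc.IH) (smt (verit) mult_nonneg_nonneg)
  hence "(\<lambda>y. if x \<le> y then \<Sum>l<n. A y i l * kap p l y (t - d i * (y - x)) else 0) = (\<lambda>y. 0)"
    by auto
  thus ?case by simp
qed

text \<open>Here the same shift moves the argument to the right.\<close>

lemma kap_eq_0_of_pos:
  assumes "\<And>i. d i \<le> 0" "t > 0"
  shows "kap p i x t = 0"
  using assms(2)
proof (induction p arbitrary: i x t)
  case 0
  thus ?case using assms(1)[of i] by (auto simp: divide_simps)
next
  case (Suc p)
  have "kap p l y (t - d i * (y - x)) = 0" if "x \<le> y" for l y
    using that assms(1)[of i] Suc.prems by (intro Suc.IH) (smt (verit) mult_nonpos_nonneg)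
  hence "(\<lambda>y. if x \<le> y then \<Sum>l<n. A y i l * kap p l y (t - d i * (y - x)) else 0) = (\<lambda>y. 0)"
    by auto
  thus ?case by simp
qed

section \<open>L1 bounds for the kernels\<close>

text \<open>The entrywise norm of the matrix; it bounds each row sum and each column sum, and so
  dominates one Picard step.\<close>

definition q :: "real \<Rightarrow> ennreal" where
  "q y = (\<Sum>i<n. \<Sum>l<n. ennreal (norm (A y i l)))"

lemma measurable_q [measurable]: "q \<in> borel_measurable borel"
  unfolding q_def by measurable

definition kap_norm :: "nat \<Rightarrow> nat \<Rightarrow> real \<Rightarrow> ennreal" where
  "kap_norm p i x = (\<integral>\<^sup>+t. norm (kap p i x t) \<partial>lborel)"

lemma measurable_kap_norm [measurable]: "kap_norm p i \<in> borel_measurable borel"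
  unfolding kap_norm_def by measurable

text \<open>Substituting t = d_i (y - x) produces the Jacobian \<open>\<bar>d i\<bar>\<close>, which
  cancels the denominator in the first kernel.\<close>

lemma kap_norm_0: "kap_norm 0 i x \<le> (\<integral>\<^sup>+y. ennreal (norm (A y i j)) * indicator {x..} y \<partial>lborel)"
proof (cases "d i = 0")
  case True
  thus ?thesis by (simp add: kap_norm_def nonresonant)
next
  case False
  have "kap_norm 0 i x = ennreal \<bar>d i\<bar> * (\<integral>\<^sup>+y. norm (kap 0 i x (- d i * x + d i * y)) \<partial>lborel)"
    unfolding kap_norm_def by (rule nn_integral_real_affine[OF _ False]) measurable
  also have "\<dots> = (\<integral>\<^sup>+y. ennreal \<bar>d i\<bar> * norm (kap 0 i x (- d i * x + d i * y)) \<partial>lborel)"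
    by (rule nn_integral_cmult[symmetric]) measurable
  also have "\<dots> \<le> (\<integral>\<^sup>+y. ennreal (norm (A y i j)) * indicator {x..} y \<partial>lborel)"
  proof (rule nn_integral_mono)
    fix y
    have "(- d i * x + d i * y) / d i = y - x" using False by (simp add: field_simps)
    thus "ennreal \<bar>d i\<bar> * norm (kap 0 i x (- d i * x + d i * y)) \<le> ennreal (norm (A y i j)) * indicator {x..} y"
      using False by (auto simp: norm_divide ennreal_mult[symmetric] simp del: mult_minus_left)
  qed
  finally show ?thesis .
qed

text \<open>Translation invariance in t removes the shift and leaves the norm of the previous kernel
  at y. The estimate serves both the norm recursion and the Fubini argument in
  \<open>fourier_Suc\<close>.\<close>

lemma nn_integral_kap_step:
  "(\<integral>\<^sup>+y. (\<integral>\<^sup>+t. norm (if x \<le> y then \<Sum>l<n. A y i l * kap p l y (t - d i * (y - x)) else 0) \<partial>lborel) \<partial>lborel)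
    \<le> (\<integral>\<^sup>+y. (\<Sum>l<n. norm (A y i l) * kap_norm p l y) * indicator {x..} y \<partial>lborel)"
proof (rule nn_integral_mono)
  fix y
  have "(\<integral>\<^sup>+t. norm (\<Sum>l<n. A y i l * kap p l y (t - d i * (y - x))) \<partial>lborel)
      \<le> (\<integral>\<^sup>+t. (\<Sum>l<n. norm (A y i l) * ennreal (norm (kap p l y (t - d i * (y - x))))) \<partial>lborel)"
    by (intro nn_integral_mono order_trans[OF ennreal_leI[OF norm_sum]])
      (simp add: norm_mult ennreal_mult flip: sum_ennreal)
  also have "\<dots> = (\<Sum>l<n. norm (A y i l) * (\<integral>\<^sup>+t. norm (kap p l y (t - d i * (y - x))) \<partial>lborel))"
    by (simp add: nn_integral_sum nn_integral_cmult)
  also have "\<dots> = (\<Sum>l<n. norm (A y i l) * kap_norm p l y)"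
    unfolding kap_norm_def
    by (intro sum.cong refl arg_cong2[of _ _ _ _ "(*)"] nn_integral_lborel_shift[of "\<lambda>t. ennreal (norm (kap p _ y t))"]) measurable
  finally show "(\<integral>\<^sup>+t. norm (if x \<le> y then \<Sum>l<n. A y i l * kap p l y (t - d i * (y - x)) else 0) \<partial>lborel)
    \<le> (\<Sum>l<n. norm (A y i l) * kap_norm p l y) * indicator {x..} y"
    by (auto split: split_indicator)
qed

lemma kap_norm_Suc:
  "kap_norm (Suc p) i x \<le> (\<integral>\<^sup>+y. (\<Sum>l<n. norm (A y i l) * kap_norm p l y) * indicator {x..} y \<partial>lborel)"
proof -
  have "kap_norm (Suc p) i x
      \<le> (\<integral>\<^sup>+t. (\<integral>\<^sup>+y. norm (if x \<le> y then \<Sum>l<n. A y i l * kap p l y (t - d i * (y - x)) else 0) \<partial>lborel) \<partial>lborel)"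
    unfolding kap_norm_def kap.simps norm_minus_cancel
    by (intro nn_integral_mono norm_integral_le_nn_integral)
  also have "\<dots> = (\<integral>\<^sup>+y. (\<integral>\<^sup>+t. norm (if x \<le> y then \<Sum>l<n. A y i l * kap p l y (t - d i * (y - x)) else 0) \<partial>lborel) \<partial>lborel)"
    by (rule lborel_pair.Fubini') measurable
  also note nn_integral_kap_step
  finally show ?thesis .
qed

text \<open>Summing over the components closes the recursion: each \<open>kap_norm p l\<close> is at
  most the whole sum, and the remaining double sum of moduli is \<open>q\<close>. The index
  \<open>Suc p\<close> counts the p + 1 factors of \<open>A\<close> in \<open>kap p\<close>.\<close>

lemma kap_norm_le_tail_iter: "(\<Sum>i<n. kap_norm p i x) \<le> tail_iter q (Suc p) x"
proof (induction p arbitrary: x)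
  case 0
  have "(\<Sum>i<n. kap_norm 0 i x) \<le> (\<Sum>i<n. \<integral>\<^sup>+y. ennreal (norm (A y i j)) * indicator {x..} y \<partial>lborel)"
    by (intro sum_mono kap_norm_0)
  also have "\<dots> = (\<integral>\<^sup>+y. (\<Sum>i<n. ennreal (norm (A y i j)) * indicator {x..} y) \<partial>lborel)"
    by (rule nn_integral_sum[symmetric]) measurable
  also have "\<dots> \<le> (\<integral>\<^sup>+y. q y * indicator {x..} y \<partial>lborel)"
  proof (intro nn_integral_mono)
    fix y
    have "(\<Sum>i<n. ennreal (norm (A y i j))) \<le> q y"
      unfolding q_def by (intro sum_mono member_le_sum) (use j in auto)
    thus "(\<Sum>i<n. ennreal (norm (A y i j)) * indicator {x..} y) \<le> q y * indicator {x..} y"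
      by (cases "x \<le> y") (simp_all del: sum_ennreal)
  qed
  finally show ?case by simp
next
  case (Suc p)
  have "(\<Sum>i<n. kap_norm (Suc p) i x)
      \<le> (\<Sum>i<n. \<integral>\<^sup>+y. (\<Sum>l<n. norm (A y i l) * kap_norm p l y) * indicator {x..} y \<partial>lborel)"
    by (intro sum_mono kap_norm_Suc)
  also have "\<dots> = (\<integral>\<^sup>+y. (\<Sum>i<n. (\<Sum>l<n. norm (A y i l) * kap_norm p l y) * indicator {x..} y) \<partial>lborel)"
    by (rule nn_integral_sum[symmetric]) measurable
  also have "\<dots> \<le> (\<integral>\<^sup>+y. q y * tail_iter q (Suc p) y * indicator {x..} y \<partial>lborel)"
  proof (intro nn_integral_mono)
    fix y
    have "kap_norm p l y \<le> tail_iter q (Suc p) y" if "l < n" for l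
      by (rule order_trans[OF member_le_sum Suc]) (use that in auto)
    hence "(\<Sum>i<n. \<Sum>l<n. norm (A y i l) * kap_norm p l y)
        \<le> (\<Sum>i<n. \<Sum>l<n. norm (A y i l) * tail_iter q (Suc p) y)"
      by (intro sum_mono mult_left_mono) (auto simp del: tail_iter.simps)
    also have "\<dots> = q y * tail_iter q (Suc p) y"
      unfolding q_def by (simp only: sum_distrib_right)
    finally show "(\<Sum>i<n. (\<Sum>l<n. norm (A y i l) * kap_norm p l y) * indicator {x..} y)
        \<le> q y * tail_iter q (Suc p) y * indicator {x..} y"
      by (cases "x \<le> y") (simp_all del: tail_iter.simps)
  qed
  finally show ?case by (simp only: tail_iter.simps(2)[of q "Suc p"])
qed

definition C :: real where
  "C = (\<Sum>i<n. \<Sum>l<n. \<integral>y. norm (A y i l) \<partial>lborel)"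

lemma C_nonneg: "0 \<le> C"
  unfolding C_def by (intro sum_nonneg) simp

lemma nn_integral_q: "(\<integral>\<^sup>+y. q y \<partial>lborel) = ennreal C"
  unfolding q_def C_def using integrable_A
  by (simp add: nn_integral_sum nn_integral_eq_integral sum_nonneg del: sum_ennreal)
    (simp add: sum_nonneg)

text \<open>The exponent is \<open>Suc p\<close> because \<open>kap p\<close> contains p + 1 factors
  of \<open>A\<close>. The terms sum to exp C - 1.\<close>

definition bd :: "nat \<Rightarrow> real" where
  "bd p = C ^ Suc p / fact (Suc p)"

lemma bd_nonneg: "0 \<le> bd p"
  unfolding bd_def using C_nonneg by (intro divide_nonneg_pos) (auto intro!: mult_nonneg_nonneg)

lemma summable_bd: "summable bd"
  unfolding bd_def
  using summable_exp_generic[of C] summable_Suc_iff[of "\<lambda>p. C ^ p / fact p"]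
  by (simp add: field_simps scaleR_conv_of_real del: fact_Suc power_Suc)

lemma kap_norm_le_bd: "i < n \<Longrightarrow> kap_norm p i x \<le> ennreal (bd p)"
proof -
  assume "i < n"
  hence "kap_norm p i x \<le> (\<Sum>i<n. kap_norm p i x)" by (intro member_le_sum) auto
  also note kap_norm_le_tail_iter
  also have "tail_iter q (Suc p) x \<le> ennreal (bd p)"
    unfolding bd_def by (rule tail_iter_le) (simp_all add: nn_integral_q C_nonneg)
  finally show ?thesis .
qed

lemma integrable_kap: "i < n \<Longrightarrow> integrable lborel (kap p i x)"
  using kap_norm_le_bd[of i p x]
  by (intro integrableI_bounded) (auto simp: kap_norm_def intro: le_less_trans)

lemma integral_norm_kap: "i < n \<Longrightarrow> (\<integral>t. norm (kap p i x t) \<partial>lborel) \<le> bd p"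
  using kap_norm_le_bd[of i p x] integrable_kap[of i p x] bd_nonneg[of p]
  by (simp add: kap_norm_def nn_integral_eq_integral)

section \<open>Fourier transforms of the kernels as Picard corrections\<close>

definition fourier :: "nat \<Rightarrow> nat \<Rightarrow> real \<Rightarrow> real \<Rightarrow> complex" where
  "fourier p i k x = (\<integral>t. exp (\<i> * of_real (k * t)) * kap p i x t \<partial>lborel)"

lemma measurable_fourier [measurable]: "fourier p i k \<in> borel_measurable borel"
  unfolding fourier_def by measurable

lemma integrable_exp_kap: "i < n \<Longrightarrow> integrable lborel (\<lambda>t. exp (\<i> * of_real (k * t)) * kap p i x t)"
  by (rule Bochner_Integration.integrable_bound[OF integrable_kap[of i p x]])
    (simp_all add: norm_mult)

lemma norm_fourier_le: "i < n \<Longrightarrow> norm (fourier p i k x) \<le> bd p"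
  unfolding fourier_def
  by (rule order_trans[OF integral_norm_bound]) (simp add: norm_mult integral_norm_kap)

text \<open>The substitution t = d_i (y - x) turns the transform of the first kernel back into the
  first Picard term.\<close>

lemma fourier_0:
  "fourier 0 i k x = - (\<integral>y. (if x \<le> y then exp (\<i> * of_real (k * d i * (y - x))) * A y i j else 0) \<partial>lborel)"
proof (cases "d i = 0")
  case True
  thus ?thesis by (simp add: fourier_def nonresonant cong: if_cong)
next
  case False
  have eq: "\<bar>d i\<bar> *\<^sub>R (exp (\<i> * of_real (k * (- d i * x + d i * y))) * kap 0 i x (- d i * x + d i * y))
    = - (if x \<le> y then exp (\<i> * of_real (k * d i * (y - x))) * A y i j else 0)" for y
  proof -
    have "(- d i * x + d i * y) / d i = y - x" using False by (simp add: field_simps)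
    moreover have "k * (- d i * x + d i * y) = k * d i * (y - x)" by (simp add: algebra_simps)
    ultimately show ?thesis
      using False by (simp add: scaleR_conv_of_real algebra_simps del: mult_minus_left)
  qed
  show ?thesis
    unfolding fourier_def
    by (subst lborel_integral_real_affine[OF False, of _ "- d i * x"],
        subst integral_scaleR_right[symmetric], subst eq, simp)
qed

text \<open>After exchanging t and y by Fubini, the translation by \<open>d i * (y - x)\<close>
  becomes a phase factor. Hence the transforms obey the Picard recursion.\<close>

lemma fourier_Suc:
  assumes i: "i < n"
  shows "fourier (Suc p) i k x =
    - (\<integral>y. (if x \<le> y then exp (\<i> * of_real (k * d i * (y - x))) * (\<Sum>l<n. A y i l * fourier p l k y) else 0) \<partial>lborel)"
proof -
  define G where "G y t = (if x \<le> y then \<Sum>l<n. A y i l * kap p l y (t - d i * (y - x)) else 0)" for y t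
  define E where "E t = exp (\<i> * complex_of_real (k * t))" for t
  have [measurable (raw)]: "(\<lambda>w. G (f w) (g w)) \<in> borel_measurable M"
    if [measurable]: "f \<in> borel_measurable M" "g \<in> borel_measurable M" for f g and M :: "(real \<times> real) measure"
    unfolding G_def by measurable
  have [measurable]: "E \<in> borel_measurable borel" unfolding E_def by measurable
  have nE: "norm (E t) = 1" for t unfolding E_def by simp
  \<comment> \<open>Fubini requires absolute integrability on the plane: the phase has modulus 1,
    the kernel norms are at most \<open>bd p\<close>, and \<open>q\<close> has total mass
    \<open>C\<close>.\<close>
  have int: "integrable (lborel \<Otimes>\<^sub>M lborel) (\<lambda>(y, t). E t * G y t)"
  proof (rule integrableI_bounded)
    have "(\<integral>\<^sup>+w. norm (case w of (y, t) \<Rightarrow> E t * G y t) \<partial>(lborel \<Otimes>\<^sub>M lborel))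
        = (\<integral>\<^sup>+y. (\<integral>\<^sup>+t. norm (G y t) \<partial>lborel) \<partial>lborel)"
      by (subst lborel.nn_integral_fst[symmetric]) (simp_all add: norm_mult nE)
    also have "\<dots> \<le> (\<integral>\<^sup>+y. (\<Sum>l<n. norm (A y i l) * kap_norm p l y) * indicator {x..} y \<partial>lborel)"
      unfolding G_def by (rule nn_integral_kap_step)
    also have "\<dots> \<le> (\<integral>\<^sup>+y. ennreal (bd p) * q y \<partial>lborel)"
    proof (rule nn_integral_mono)
      fix y
      have "(\<Sum>l<n. norm (A y i l) * kap_norm p l y) \<le> (\<Sum>l<n. norm (A y i l) * ennreal (bd p))"
        by (intro sum_mono mult_left_mono kap_norm_le_bd) auto
      also have "\<dots> = ennreal (bd p) * (\<Sum>l<n. ennreal (norm (A y i l)))"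
        by (simp only: sum_distrib_left mult.commute)
      also have "\<dots> \<le> ennreal (bd p) * q y"
        unfolding q_def using i
        by (intro mult_left_mono member_le_sum[of i "{..<n}" "\<lambda>i. \<Sum>l<n. ennreal (norm (A y i l))"]) simp_all
      finally show "(\<Sum>l<n. norm (A y i l) * kap_norm p l y) * indicator {x..} y \<le> ennreal (bd p) * q y"
        by (cases "x \<le> y") simp_all
    qed
    also have "\<dots> = ennreal (bd p) * ennreal C"
      by (subst nn_integral_cmult) (simp_all add: nn_integral_q)
    also have "\<dots> < \<infinity>" by (simp add: ennreal_mult_less_top)
    finally show "(\<integral>\<^sup>+w. norm (case w of (y, t) \<Rightarrow> E t * G y t) \<partial>(lborel \<Otimes>\<^sub>M lborel)) < \<infinity>" .
  qed measurable
  have inner: "(\<integral>t. E t * G y t \<partial>lborel) =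
      (if x \<le> y then exp (\<i> * of_real (k * d i * (y - x))) * (\<Sum>l<n. A y i l * fourier p l k y) else 0)" for y
  proof (cases "x \<le> y")
    case True
    let ?c = "d i * (y - x)"
    have E_add: "E (?c + s) = E ?c * E s" for s
      unfolding E_def by (simp add: exp_add[symmetric] algebra_simps)
    have *: "(\<integral>t. E t * kap p l y (t - ?c) \<partial>lborel) = E ?c * fourier p l k y" for l
      using lborel_integral_real_affine[of 1 "\<lambda>t. E t * kap p l y (t - ?c)" ?c]
      by (simp add: E_add mult.assoc) (simp add: fourier_def E_def)
    have int1: "integrable lborel (\<lambda>t. E t * kap p l y (t - ?c))" if "l < n" for l
    proof (rule Bochner_Integration.integrable_bound)
      show "integrable lborel (\<lambda>t. kap p l y (t - ?c))"
        using lborel_integrable_real_affine[OF integrable_kap[OF that, of p y], of 1 "- ?c"] by simp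
    qed (simp_all add: norm_mult nE)
    have "(\<integral>t. E t * G y t \<partial>lborel) = (\<integral>t. (\<Sum>l<n. A y i l * (E t * kap p l y (t - ?c))) \<partial>lborel)"
      using True by (simp add: G_def sum_distrib_left mult_ac)
    also have "\<dots> = (\<Sum>l<n. A y i l * (E ?c * fourier p l k y))"
      by (subst Bochner_Integration.integral_sum) (auto intro!: int1 simp: *)
    also have "\<dots> = E ?c * (\<Sum>l<n. A y i l * fourier p l k y)"
      by (simp add: sum_distrib_left mult_ac)
    finally show ?thesis using True by (simp add: E_def mult.assoc)
  qed (simp add: G_def)
  have "fourier (Suc p) i k x = (\<integral>t. - (\<integral>y. E t * G y t \<partial>lborel) \<partial>lborel)"
    unfolding fourier_def kap.simps by (simp add: E_def G_def)
  also have "\<dots> = - (\<integral>t. (\<integral>y. E t * G y t \<partial>lborel) \<partial>lborel)" by simp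
  also have "(\<integral>t. (\<integral>y. E t * G y t \<partial>lborel) \<partial>lborel) = (\<integral>y. (\<integral>t. E t * G y t \<partial>lborel) \<partial>lborel)"
    by (rule lborel_pair.Fubini_integral[OF int])
  finally show ?thesis unfolding inner .
qed

section \<open>Summation of the kernels\<close>

definition kern :: "nat \<Rightarrow> real \<Rightarrow> real \<Rightarrow> complex" where
  "kern i x t = (\<Sum>p. kap p i x t)"

text \<open>The Picard series of the column. It is defined through the transforms rather than
  through \<open>kern\<close>, so that the Volterra equation can be checked term by term.\<close>

definition sol :: "real \<Rightarrow> nat \<Rightarrow> real \<Rightarrow> complex" where
  "sol k i x = idm i j + (\<Sum>p. fourier p i k x)"

lemma integrable_kern: "i < n \<Longrightarrow> integrable lborel (kern i x)"
  and integral_norm_kern: "i < n \<Longrightarrow> (\<integral>t. norm (kern i x t) \<partial>lborel) \<le> (\<Sum>p. bd p)"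
  unfolding kern_def
  by (rule integral_suminf_norm_bounds[OF integrable_kap integral_norm_kap summable_bd]; assumption)+

text \<open>The phase has modulus 1, so the bounds on the kernels also justify exchanging the series
  with the Fourier integral.\<close>

lemma sol_eq_fourier_kern:
  assumes i: "i < n"
  shows "sol k i x = idm i j + (\<integral>t. exp (\<i> * of_real (k * t)) * kern i x t \<partial>lborel)"
proof -
  let ?f = "\<lambda>p t. exp (\<i> * of_real (k * t)) * kap p i x t"
  have "(\<integral>t. exp (\<i> * of_real (k * t)) * kern i x t \<partial>lborel) = (\<integral>t. (\<Sum>p. ?f p t) \<partial>lborel)"
  proof (rule integral_cong_AE)
    \<comment> \<open>The phase can be taken out of the series where the series converges, which is
      known for almost every t.\<close>
    have "AE t in lborel. summable (\<lambda>p. norm (kap p i x t))"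
      by (rule integral_suminf_norm_bounds[OF integrable_kap[OF i] integral_norm_kap[OF i] summable_bd])
    thus "AE t in lborel. exp (\<i> * of_real (k * t)) * kern i x t = (\<Sum>p. ?f p t)"
      by eventually_elim (simp add: kern_def suminf_mult summable_norm_cancel)
  qed (simp_all add: kern_def)
  also have "\<dots> = (\<Sum>p. fourier p i k x)"
    unfolding fourier_def
    by (rule integral_suminf_norm_bounds(3)[OF integrable_exp_kap[OF i] _ summable_bd])
      (simp add: norm_mult integral_norm_kap[OF i])
  finally show ?thesis by (simp add: sol_def)
qed

lemma kern_eq_0_of_neg: "(\<And>i. 0 \<le> d i) \<Longrightarrow> t < 0 \<Longrightarrow> kern i x t = 0"
  by (simp add: kern_def kap_eq_0_of_neg)

lemma kern_eq_0_of_pos: "(\<And>i. d i \<le> 0) \<Longrightarrow> t > 0 \<Longrightarrow> kern i x t = 0"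
  by (simp add: kern_def kap_eq_0_of_pos)

end

section \<open>The Volterra equation for a column\<close>

lemma integrable_oscillating_tail:
  fixes g :: "real \<Rightarrow> complex"
  assumes "integrable lborel g"
  shows "integrable lborel (\<lambda>y. if x \<le> y then exp (\<i> * of_real (c * (y - x))) * g y else 0)"
proof (rule Bochner_Integration.integrable_bound[OF assms])
  have [measurable]: "g \<in> borel_measurable borel" using assms by auto
  show "(\<lambda>y. if x \<le> y then exp (\<i> * of_real (c * (y - x))) * g y else 0) \<in> borel_measurable lborel"
    by measurable
qed (simp add: norm_mult)

text \<open>Dominated convergence with majorant \<open>norm (g y)\<close>. The jump of the integrand
  at y = x sits on a null set.\<close>

lemma continuous_on_oscillating_tail_integral:
  fixes g :: "real \<Rightarrow> complex"
  assumes g: "integrable lborel g"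
  shows "continuous_on UNIV (\<lambda>x. \<integral>y. (if x \<le> y then exp (\<i> * of_real (c * (y - x))) * g y else 0) \<partial>lborel)"
    (is "continuous_on UNIV (\<lambda>x. \<integral>y. ?F x y \<partial>lborel)")
proof -
  have [measurable]: "g \<in> borel_measurable borel" using g by auto
  have "(\<lambda>m. \<integral>y. ?F (u m) y \<partial>lborel) \<longlonglongrightarrow> (\<integral>y. ?F x y \<partial>lborel)" if u: "u \<longlonglongrightarrow> x" for u x
  proof (rule integral_dominated_convergence[where w = "\<lambda>y. norm (g y)"])
    show "AE y in lborel. (\<lambda>m. ?F (u m) y) \<longlonglongrightarrow> ?F x y"
      using AE_lborel_singleton[of x]
    proof eventually_elim
      case (elim y)
      have lim: "(\<lambda>m. exp (\<i> * of_real (c * (y - u m))) * g y) \<longlonglongrightarrow> exp (\<i> * of_real (c * (y - x))) * g y"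
        using u by (intro tendsto_intros)
      show ?case
      proof (cases "x < y")
        case True
        hence "\<forall>\<^sub>F m in sequentially. u m < y" using u by (simp add: order_tendstoD)
        hence "\<forall>\<^sub>F m in sequentially. exp (\<i> * of_real (c * (y - u m))) * g y = ?F (u m) y"
          by eventually_elim simp
        thus ?thesis using True Lim_transform_eventually[OF lim] by simp
      next
        case False
        hence "\<forall>\<^sub>F m in sequentially. u m > y" using u elim by (simp add: order_tendstoD)
        hence "\<forall>\<^sub>F m in sequentially. ?F (u m) y = 0"
          by eventually_elim simp
        thus ?thesis using False elim by (simp add: tendsto_eventually)
      qed
    qed
    show "integrable lborel (\<lambda>y. norm (g y))" using g by simp
  qed (auto simp: norm_mult)
  thus ?thesis by (auto simp: continuous_on_sequentially o_def)
qed

lemma set_integral_atLeast_if: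
  fixes f :: "real \<Rightarrow> complex"
  shows "(LINT y:{x..}|lborel. f y) = (\<integral>y. (if x \<le> y then f y else 0) \<partial>lborel)"
    and "set_integrable lborel {x..} f \<longleftrightarrow> integrable lborel (\<lambda>y. if x \<le> y then f y else 0)"
proof -
  have "(\<lambda>y. indicat_real {x..} y *\<^sub>R f y) = (\<lambda>y. if x \<le> y then f y else 0)" by auto
  thus "(LINT y:{x..}|lborel. f y) = (\<integral>y. (if x \<le> y then f y else 0) \<partial>lborel)"
    and "set_integrable lborel {x..} f \<longleftrightarrow> integrable lborel (\<lambda>y. if x \<le> y then f y else 0)"
    by (simp_all add: set_lebesgue_integral_def set_integrable_def)
qed

text \<open>The column equation after the phase of the column is divided out, with phase speeds
  \<open>c\<close> and constant term \<open>v\<close> left free. Continuity and integrability are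
  included just as in \<open>is_jost_psi\<close>.\<close>

definition volterra_sol :: "nat \<Rightarrow> (real \<Rightarrow> nat \<Rightarrow> nat \<Rightarrow> complex) \<Rightarrow> (nat \<Rightarrow> real) \<Rightarrow> (nat \<Rightarrow> complex)
    \<Rightarrow> (nat \<Rightarrow> real \<Rightarrow> complex) \<Rightarrow> bool" where
  "volterra_sol n A c v m \<longleftrightarrow> (\<forall>i<n. continuous_on UNIV (m i) \<and>
    (\<forall>x. set_integrable lborel {x..} (\<lambda>y. exp (\<i> * of_real (c i * (y - x))) * (\<Sum>l<n. A y i l * m l y)) \<and>
      m i x = v i - (LINT y:{x..}|lborel. exp (\<i> * of_real (c i * (y - x))) * (\<Sum>l<n. A y i l * m l y))))"

context akns_column
begin

section \<open>Existence: the Picard series solves the column equation\<close>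

lemma summable_fourier: "l < n \<Longrightarrow> summable (\<lambda>p. fourier p l k y)"
  by (rule summable_comparison_test'[OF summable_bd, of 0]) (simp add: norm_fourier_le)

lemma norm_sol_le:
  assumes "l < n"
  shows "norm (sol k l y) \<le> 1 + (\<Sum>p. bd p)"
proof -
  have s: "summable (\<lambda>p. norm (fourier p l k y))"
    by (rule summable_comparison_test'[OF summable_bd, of 0]) (simp add: norm_fourier_le assms)
  have "norm (\<Sum>p. fourier p l k y) \<le> (\<Sum>p. bd p)"
    by (rule order_trans[OF summable_norm[OF s]]) (intro suminf_le s summable_bd norm_fourier_le assms)
  moreover have "norm (idm l j) \<le> 1" by (simp add: idm_def)
  ultimately show ?thesis
    unfolding sol_def by (meson add_mono norm_triangle_le)
qed

lemma measurable_sol [measurable]: "sol k l \<in> borel_measurable borel"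
  unfolding sol_def by measurable

lemma integrable_A_mult:
  assumes [measurable]: "h \<in> borel_measurable borel" and "\<And>y. norm (h y) \<le> B"
  shows "integrable lborel (\<lambda>y. A y i l * h y)"
proof (rule Bochner_Integration.integrable_bound)
  show "integrable lborel (\<lambda>y. norm (A y i l) * B)" using integrable_A by simp
  show "AE y in lborel. norm (A y i l * h y) \<le> norm (norm (A y i l) * B)"
    by (rule AE_I2) (metis assms(2) mult_left_mono norm_ge_zero norm_mult order_trans real_norm_def abs_ge_self)
qed measurable

lemma integrable_A_sol: "integrable lborel (\<lambda>y. \<Sum>l<n. A y i l * sol k l y)"
  by (intro Bochner_Integration.integrable_sum integrable_A_mult[OF _ norm_sol_le]) auto

text \<open>Inserting the series under the integral shifts the Picard index by one: the constant
  term yields \<open>fourier 0\<close>, and the p-th term yields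
  \<open>fourier (Suc p)\<close>.\<close>

lemma sol_volterra_eq:
  assumes i: "i < n"
  shows "sol k i x = idm i j -
    (\<integral>y. (if x \<le> y then exp (\<i> * of_real (k * d i * (y - x))) * (\<Sum>l<n. A y i l * sol k l y) else 0) \<partial>lborel)"
proof -
  let ?e = "\<lambda>y. exp (\<i> * complex_of_real (k * d i * (y - x)))"
  define f where "f p y = (if x \<le> y then ?e y * (\<Sum>l<n. A y i l * fourier p l k y) else 0)" for p y
  have intA: "integrable lborel (\<lambda>y. \<Sum>l<n. A y i l * fourier p l k y)" for p
    by (intro Bochner_Integration.integrable_sum integrable_A_mult[OF _ norm_fourier_le]) auto
  have int: "integrable lborel (f p)" for p
    unfolding f_def by (rule integrable_oscillating_tail[OF intA])
  \<comment> \<open>The transforms are bounded by \<open>bd p\<close> uniformly in y, which leaves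
    the integral of the i-th row sum, at most \<open>C\<close>.\<close>
  have le: "(\<integral>y. norm (f p y) \<partial>lborel) \<le> bd p * C" for p
  proof -
    have "(\<integral>y. norm (f p y) \<partial>lborel) \<le> (\<integral>y. bd p * (\<Sum>l<n. norm (A y i l)) \<partial>lborel)"
    proof (rule integral_mono)
      show "integrable lborel (\<lambda>y. norm (f p y))" using int by simp
      show "integrable lborel (\<lambda>y. bd p * (\<Sum>l<n. norm (A y i l)))" using integrable_A by simp
      fix y
      have "norm (\<Sum>l<n. A y i l * fourier p l k y) \<le> (\<Sum>l<n. norm (A y i l) * bd p)"
        by (intro order_trans[OF norm_sum] sum_mono) (auto simp: norm_mult intro!: mult_left_mono norm_fourier_le)
      also have "\<dots> = bd p * (\<Sum>l<n. norm (A y i l))"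
        by (simp add: sum_distrib_left mult.commute)
      finally show "norm (f p y) \<le> bd p * (\<Sum>l<n. norm (A y i l))"
        using bd_nonneg[of p] by (auto simp: f_def norm_mult sum_nonneg)
    qed
    also have "\<dots> = bd p * (\<Sum>l<n. \<integral>y. norm (A y i l) \<partial>lborel)"
      using integrable_A by (simp add: Bochner_Integration.integral_sum)
    also have "\<dots> \<le> bd p * C"
      unfolding C_def using i bd_nonneg
      by (intro mult_left_mono member_le_sum[of i "{..<n}" "\<lambda>i. \<Sum>l<n. \<integral>y. norm (A y i l) \<partial>lborel"])
        (auto intro!: sum_nonneg)
    finally show ?thesis .
  qed
  note sums = integral_suminf_norm_bounds[OF int le summable_mult2[OF summable_bd, of C]]
  have delta: "(\<Sum>l<n. A y i l * idm l j) = A y i j" for y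
    using j by (simp add: idm_def if_distrib cong: if_cong)
  have A_sol: "(\<Sum>l<n. A y i l * sol k l y) = A y i j + (\<Sum>p. \<Sum>l<n. A y i l * fourier p l k y)" for y
  proof -
    have "(\<Sum>p. \<Sum>l<n. A y i l * fourier p l k y) = (\<Sum>l<n. \<Sum>p. A y i l * fourier p l k y)"
      by (rule suminf_sum) (auto intro!: summable_mult summable_fourier)
    also have "\<dots> = (\<Sum>l<n. A y i l * (\<Sum>p. fourier p l k y))"
      by (intro sum.cong refl suminf_mult) (auto intro: summable_fourier)
    finally show ?thesis
      by (simp add: sol_def distrib_left sum.distrib delta)
  qed
  have split: "(if x \<le> y then ?e y * (\<Sum>l<n. A y i l * sol k l y) else 0)
      = (if x \<le> y then ?e y * A y i j else 0) + (\<Sum>p. f p y)" for y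
  proof -
    have "summable (\<lambda>p. \<Sum>l<n. A y i l * fourier p l k y)"
      by (intro summable_sum summable_mult summable_fourier) auto
    thus ?thesis unfolding A_sol f_def by (simp add: distrib_left suminf_mult)
  qed
  have "(\<integral>y. (if x \<le> y then ?e y * (\<Sum>l<n. A y i l * sol k l y) else 0) \<partial>lborel)
      = (\<integral>y. (if x \<le> y then ?e y * A y i j else 0) \<partial>lborel) + (\<integral>y. (\<Sum>p. f p y) \<partial>lborel)"
    unfolding split
    by (rule Bochner_Integration.integral_add[OF integrable_oscillating_tail[OF integrable_A] sums(2)])
  also have "\<dots> = - fourier 0 i k x + (\<Sum>p. \<integral>y. f p y \<partial>lborel)"
    by (simp add: fourier_0 sums(3))
  also have "(\<Sum>p. \<integral>y. f p y \<partial>lborel) = (\<Sum>p. - fourier (Suc p) i k x)"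
    unfolding fourier_Suc[OF i] f_def by simp
  also have "\<dots> = - (\<Sum>p. fourier (Suc p) i k x)"
    by (intro suminf_minus summable_Suc_iff[THEN iffD2] summable_fourier[OF i])
  also have "(\<Sum>p. fourier (Suc p) i k x) = (\<Sum>p. fourier p i k x) - fourier 0 i k x"
    by (rule suminf_split_head[OF summable_fourier[OF i]])
  finally show ?thesis unfolding sol_def by simp
qed

lemma volterra_sol_sol: "volterra_sol n A (\<lambda>i. k * d i) (\<lambda>i. idm i j) (sol k)"
  unfolding volterra_sol_def set_integral_atLeast_if
proof (intro allI impI conjI)
  fix i x assume i: "i < n"
  show "sol k i x = idm i j - (\<integral>y. (if x \<le> y
    then exp (\<i> * of_real (k * d i * (y - x))) * (\<Sum>l<n. A y i l * sol k l y) else 0) \<partial>lborel)"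
    by (rule sol_volterra_eq[OF i])
  show "integrable lborel (\<lambda>y. if x \<le> y
    then exp (\<i> * of_real (k * d i * (y - x))) * (\<Sum>l<n. A y i l * sol k l y) else 0)"
    by (rule integrable_oscillating_tail[OF integrable_A_sol])
  \<comment> \<open>Continuity is read off from the equation: its right-hand side contains the tail
    integral of an integrable function.\<close>
  have "continuous_on UNIV (\<lambda>x. idm i j - (\<integral>y. (if x \<le> y
    then exp (\<i> * of_real (k * d i * (y - x))) * (\<Sum>l<n. A y i l * sol k l y) else 0) \<partial>lborel))"
    by (intro continuous_on_diff continuous_on_const continuous_on_oscillating_tail_integral integrable_A_sol)
  thus "continuous_on UNIV (sol k i)"
    by (subst continuous_on_cong[OF refl sol_volterra_eq[OF i]])
qed

section \<open>Uniqueness for the column equation\<close>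

text \<open>Gronwall's argument by iteration. Only moduli enter, so the phases are arbitrary; the
  total norm is at most B times \<open>tail_iter q p\<close> for every p, and this bound tends to 0
  like C^p / p!.\<close>

lemma volterra_homogeneous_eq_0:
  assumes meas [measurable]: "\<And>i. w i \<in> borel_measurable borel"
    and int: "\<And>i x. i < n \<Longrightarrow> integrable lborel
      (\<lambda>y. if x \<le> y then exp (\<i> * of_real (c i * (y - x))) * (\<Sum>l<n. A y i l * w l y) else 0)"
    and eq: "\<And>i x. i < n \<Longrightarrow> w i x =
      - (\<integral>y. (if x \<le> y then exp (\<i> * of_real (c i * (y - x))) * (\<Sum>l<n. A y i l * w l y) else 0) \<partial>lborel)"
    and i: "i < n"
  shows "w i x = 0"
proof -
  define V where "V x = (\<Sum>i<n. ennreal (norm (w i x)))" for x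
  define g where "g i y = ennreal (norm (\<Sum>l<n. A y i l * w l y))" for i y
  have [measurable]: "g i \<in> borel_measurable borel" for i unfolding g_def by measurable
  have [measurable]: "V \<in> borel_measurable borel" unfolding V_def by measurable
  have tail: "(\<integral>\<^sup>+y. norm (if x \<le> y then exp (\<i> * of_real (c i * (y - x))) * (\<Sum>l<n. A y i l * w l y) else 0) \<partial>lborel)
      = (\<integral>\<^sup>+y. g i y * indicator {x..} y \<partial>lborel)" for i x
    by (intro nn_integral_cong) (auto simp: g_def norm_mult)
  have w_le: "ennreal (norm (w i x)) \<le> (\<integral>\<^sup>+y. g i y * indicator {x..} y \<partial>lborel)" if "i < n" for i x
    unfolding eq[OF that] norm_minus_cancel tail[symmetric]
    by (rule norm_integral_le_nn_integral)
  have g_fin: "(\<integral>\<^sup>+y. g i y * indicator {x..} y \<partial>lborel) < \<infinity>" if "i < n" for i x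
    using int[OF that, of x] unfolding integrable_iff_bounded tail by blast
  have sum_g: "(\<Sum>i<n. g i y) \<le> q y * V y" for y
  proof -
    have "g i y \<le> (\<Sum>l<n. ennreal (norm (A y i l))) * V y" for i
    proof -
      have "g i y \<le> (\<Sum>l<n. ennreal (norm (A y i l)) * ennreal (norm (w l y)))"
        unfolding g_def by (intro order_trans[OF ennreal_leI[OF norm_sum]])
          (simp add: norm_mult ennreal_mult flip: sum_ennreal)
      also have "\<dots> \<le> (\<Sum>l<n. ennreal (norm (A y i l)) * V y)"
        unfolding V_def by (intro sum_mono mult_left_mono member_le_sum) auto
      finally show ?thesis by (simp only: sum_distrib_right)
    qed
    hence "(\<Sum>i<n. g i y) \<le> (\<Sum>i<n. (\<Sum>l<n. ennreal (norm (A y i l))) * V y)"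
      by (intro sum_mono)
    thus ?thesis by (simp only: q_def sum_distrib_right)
  qed
  have V_le_g: "V x \<le> (\<integral>\<^sup>+y. (\<Sum>i<n. g i y) * indicator {x..} y \<partial>lborel)" for x
  proof -
    have "V x \<le> (\<Sum>i<n. \<integral>\<^sup>+y. g i y * indicator {x..} y \<partial>lborel)"
      unfolding V_def by (intro sum_mono w_le) auto
    also have "\<dots> = (\<integral>\<^sup>+y. (\<Sum>i<n. g i y * indicator {x..} y) \<partial>lborel)"
      by (rule nn_integral_sum[symmetric]) measurable
    finally show ?thesis by (simp only: sum_distrib_right)
  qed
  \<comment> \<open>Finiteness of B follows from the assumed integrability of the integrands, so
    \<open>w\<close> need not be bounded beforehand.\<close>
  define B where "B = (\<integral>\<^sup>+y. (\<Sum>i<n. g i y) * indicator {x..} y \<partial>lborel)"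
  have "B = (\<Sum>i<n. \<integral>\<^sup>+y. g i y * indicator {x..} y \<partial>lborel)"
    unfolding B_def sum_distrib_right by (rule nn_integral_sum) measurable
  hence "B < \<infinity>" using g_fin[of _ x] by (auto simp: less_top)
  then obtain \<beta> where \<beta>: "B = ennreal \<beta>" "0 \<le> \<beta>" by (cases B) auto
  \<comment> \<open>The tail integral from z \<ge> x involves only points y \<ge> z, so the single
    constant B serves the whole iteration.\<close>
  have V_le: "V z \<le> B * tail_iter q p z" if "x \<le> z" for p z
    using that
  proof (induction p arbitrary: z)
    case 0
    have "V z \<le> (\<integral>\<^sup>+y. (\<Sum>i<n. g i y) * indicator {z..} y \<partial>lborel)" by (rule V_le_g)
    also have "\<dots> \<le> B"
      unfolding B_def using 0 by (intro nn_integral_mono mult_left_mono) (auto split: split_indicator)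
    finally show ?case by simp
  next
    case (Suc p)
    have "V z \<le> (\<integral>\<^sup>+y. (\<Sum>i<n. g i y) * indicator {z..} y \<partial>lborel)" by (rule V_le_g)
    also have "\<dots> \<le> (\<integral>\<^sup>+y. B * (q y * tail_iter q p y * indicator {z..} y) \<partial>lborel)"
    proof (rule nn_integral_mono)
      fix y
      show "(\<Sum>i<n. g i y) * indicator {z..} y \<le> B * (q y * tail_iter q p y * indicator {z..} y)"
      proof (cases "z \<le> y")
        case True
        have "(\<Sum>i<n. g i y) \<le> q y * V y" by (rule sum_g)
        also have "\<dots> \<le> q y * (B * tail_iter q p y)"
          using Suc True by (intro mult_left_mono) auto
        finally show ?thesis using True by (simp add: mult_ac)
      qed simp
    qed
    also have "\<dots> = B * tail_iter q (Suc p) z"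
      by (subst nn_integral_cmult) simp_all
    finally show ?case .
  qed
  have "norm (w i x) \<le> \<beta> * (C ^ p / fact p)" for p
  proof -
    have "ennreal (norm (w i x)) \<le> V x"
      unfolding V_def using i by (intro member_le_sum[of i "{..<n}" "\<lambda>i. ennreal (norm (w i x))"]) auto
    also have "\<dots> \<le> B * tail_iter q p x" by (rule V_le) simp
    also have "\<dots> \<le> ennreal \<beta> * ennreal (C ^ p / fact p)"
      unfolding \<beta> by (intro mult_left_mono tail_iter_le) (simp_all add: nn_integral_q C_nonneg)
    also have "\<dots> = ennreal (\<beta> * (C ^ p / fact p))"
      using \<beta> C_nonneg by (simp add: ennreal_mult[symmetric])
    finally show ?thesis using \<beta> C_nonneg by (subst (asm) ennreal_le_iff) auto
  qed
  moreover have "(\<lambda>p. \<beta> * (C ^ p / fact p)) \<longlonglongrightarrow> \<beta> * 0"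
    using summable_LIMSEQ_zero[OF summable_exp_generic[of C]]
    by (intro tendsto_mult tendsto_const) (simp add: field_simps)
  ultimately have "norm (w i x) \<le> \<beta> * 0"
    by (intro LIMSEQ_le_const) auto
  thus ?thesis by simp
qed

lemma volterra_sol_unique:
  assumes m: "volterra_sol n A c v m" and m': "volterra_sol n A c v m'" and i: "i < n"
  shows "m i x = m' i x"
proof -
  \<comment> \<open>Components outside the range are set to 0, because the homogeneous lemma asks
    for measurability at every index.\<close>
  define w where "w i x = (if i < n then m i x - m' i x else 0)" for i x
  have "w i x = 0"
  proof (rule volterra_homogeneous_eq_0[OF _ _ _ i, of w c])
    fix i
    show "w i \<in> borel_measurable borel"
    proof (cases "i < n")
      case True
      hence "w i = (\<lambda>x. m i x - m' i x)" by (simp add: w_def fun_eq_iff)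
      moreover have "continuous_on UNIV (m i)" "continuous_on UNIV (m' i)"
        using m m' True unfolding volterra_sol_def by blast+
      ultimately show ?thesis
        by (auto intro!: borel_measurable_continuous_onI continuous_on_diff)
    next
      case False
      hence "w i = (\<lambda>x. 0)" by (simp add: w_def fun_eq_iff)
      thus ?thesis by simp
    qed
  next
    fix i x assume i: "i < n"
    let ?f = "\<lambda>m y. if x \<le> y then exp (\<i> * of_real (c i * (y - x))) * (\<Sum>l<n. A y i l * m l y) else 0"
    have eq: "?f w = (\<lambda>y. ?f m y - ?f m' y)"
      by (auto simp: w_def fun_eq_iff algebra_simps sum_subtractf)
    have int: "integrable lborel (?f m)" "integrable lborel (?f m')"
      and val: "m i x = v i - integral\<^sup>L lborel (?f m)" "m' i x = v i - integral\<^sup>L lborel (?f m')"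
      using m m' i unfolding volterra_sol_def set_integral_atLeast_if by blast+
    show "integrable lborel (?f w)" unfolding eq using int by simp
    show "w i x = - integral\<^sup>L lborel (?f w)"
      unfolding eq using int i by (simp add: w_def val)
  qed
  thus ?thesis using i by (simp add: w_def)
qed

end

section \<open>Jost and Faddeev matrices\<close>

text \<open>The locale makes assumptions at all natural indices, whereas
  \<open>admissible_pot\<close> controls Q on the matrix range; extension by 0 bridges the
  gap.\<close>

definition cutoff :: "nat \<Rightarrow> (real \<Rightarrow> nat \<Rightarrow> nat \<Rightarrow> complex) \<Rightarrow> real \<Rightarrow> nat \<Rightarrow> nat \<Rightarrow> complex" where
  "cutoff n Q x i l = (if i < n \<and> l < n then Q x i l else 0)"

text \<open>Equal diagonal entries of \<Sigma> belong to the same block, and the diagonal blocks of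
  the potential vanish. This is the source of \<open>nonresonant\<close>.\<close>

lemma akns_column_cutoff:
  assumes Q: "admissible_pot mp mm Q" and j: "j < dimn mp mm"
  shows "akns_column (dimn mp mm) j (\<lambda>i. sig mp j - sig mp i) (cutoff (dimn mp mm) Q)"
proof
  fix i l
  show "integrable lborel (\<lambda>x. cutoff (dimn mp mm) Q x i l)"
    using Q by (cases "i < dimn mp mm"; cases "l < dimn mp mm") (simp_all add: cutoff_def admissible_pot_def)
next
  fix x i assume "sig mp j - sig mp i = 0"
  hence "i < mp \<and> j < mp \<or> i = mp \<and> j = mp \<or> mp < i \<and> mp < j"
    by (auto simp: sig_def split: if_splits)
  thus "cutoff (dimn mp mm) Q x i j = 0"
    using Q by (auto simp: cutoff_def admissible_pot_def)
qed fact

text \<open>Exports the locale results for the actual system. On the diagonal of \<Sigma> the entry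
  1 is the largest and -1 the smallest, which fixes the sign of all \<open>d i\<close> in a plus or
  minus column. Neither the kernel nor \<open>B\<close> depends on k.\<close>

lemma column_solution:
  assumes Q: "admissible_pot mp mm Q" and j: "j < dimn mp mm"
  obtains S kern B where
    "\<And>k. volterra_sol (dimn mp mm) (cutoff (dimn mp mm) Q) (\<lambda>i. k * (sig mp j - sig mp i)) (\<lambda>i. idm i j) (S k)"
    "\<And>k i x. i < dimn mp mm \<Longrightarrow> S k i x = idm i j + (\<integral>t. exp (\<i> * of_real (k * t)) * kern i x t \<partial>lborel)"
    "\<And>i x. i < dimn mp mm \<Longrightarrow> integrable lborel (kern i x)"
    "\<And>i x. i < dimn mp mm \<Longrightarrow> (\<integral>t. norm (kern i x t) \<partial>lborel) \<le> B"
    "\<And>i x t. j < mp \<Longrightarrow> t < 0 \<Longrightarrow> kern i x t = 0"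
    "\<And>i x t. mp < j \<Longrightarrow> t > 0 \<Longrightarrow> kern i x t = 0"
proof -
  interpret akns_column "dimn mp mm" j "\<lambda>i. sig mp j - sig mp i" "cutoff (dimn mp mm) Q"
    by (rule akns_column_cutoff[OF Q j])
  have "0 \<le> sig mp j - sig mp i" if "j < mp" for i using that by (simp add: sig_def)
  moreover have "sig mp j - sig mp i \<le> 0" if "mp < j" for i using that by (simp add: sig_def)
  ultimately show thesis
    by (intro that[OF volterra_sol_sol sol_eq_fourier_kern integrable_kern integral_norm_kern]
        kern_eq_0_of_neg kern_eq_0_of_pos)
qed

section \<open>From Jost matrices to columns of Faddeev matrices\<close>

lemma mult_phase_cancel: "a * exp (- \<i> * of_real r) * exp (\<i> * of_real r) = a"
  by (simp add: mult.assoc exp_add[symmetric])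

text \<open>Multiplication by the nowhere vanishing phase of column j turns the Jost equation into
  the Faddeev equation. Since \<Q>(y) multiplies from the left, the columns decouple.\<close>

lemma is_jost_psi_iff:
  fixes mp mm :: nat
  defines "n \<equiv> dimn mp mm"
  shows "is_jost_psi mp mm Q Psi \<longleftrightarrow>
    (\<forall>x k i j. \<not> (i < n \<and> j < n) \<longrightarrow> Psi x k i j = 0) \<and>
    (\<forall>k. \<forall>j<n. volterra_sol n (cutoff n Q) (\<lambda>i. k * (sig mp j - sig mp i)) (\<lambda>i. idm i j)
      (\<lambda>i x. Psi x k i j * exp (- \<i> * of_real (k * x * sig mp j))))"
proof -
  have entry: "(continuous_on UNIV (\<lambda>x. Psi x k i j) \<and>
       (\<forall>x. set_integrable lborel {x..}
              (\<lambda>y. exp (- \<i> * of_real (k * (y - x) * sig mp i)) * (\<Sum>l<n. Q y i l * Psi y k l j)) \<and>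
            Psi x k i j = idm i j * exp (\<i> * of_real (k * x * sig mp i))
              - (LINT y:{x..}|lborel. exp (- \<i> * of_real (k * (y - x) * sig mp i)) *
                    (\<Sum>l<n. Q y i l * Psi y k l j))))
    \<longleftrightarrow> (continuous_on UNIV (\<lambda>x. Psi x k i j * exp (- \<i> * of_real (k * x * sig mp j))) \<and>
       (\<forall>x. set_integrable lborel {x..}
              (\<lambda>y. exp (\<i> * of_real (k * (sig mp j - sig mp i) * (y - x))) *
                (\<Sum>l<n. cutoff n Q y i l * (Psi y k l j * exp (- \<i> * of_real (k * y * sig mp j))))) \<and>
            Psi x k i j * exp (- \<i> * of_real (k * x * sig mp j)) = idm i j
              - (LINT y:{x..}|lborel. exp (\<i> * of_real (k * (sig mp j - sig mp i) * (y - x))) *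
                (\<Sum>l<n. cutoff n Q y i l * (Psi y k l j * exp (- \<i> * of_real (k * y * sig mp j)))))))"
    (is "?c \<and> (\<forall>x. ?i x \<and> ?v x) \<longleftrightarrow> ?c' \<and> (\<forall>x. ?i' x \<and> ?v' x)")
    if i: "i < n" and "j < n" for i j k
  proof -
    let ?E = "\<lambda>x. exp (- \<i> * of_real (k * x * sig mp j))"
    have E: "?E x \<noteq> 0" "exp (\<i> * of_real (k * x * sig mp j)) * ?E x = 1" for x
      by (simp_all add: exp_add[symmetric])
    have c: "?c \<longleftrightarrow> ?c'"
    proof
      assume ?c'
      moreover have "continuous_on UNIV (\<lambda>x. exp (\<i> * complex_of_real (k * x * sig mp j)))"
        by (intro continuous_intros)
      ultimately have "continuous_on UNIV (\<lambda>x. (Psi x k i j * ?E x) * exp (\<i> * of_real (k * x * sig mp j)))"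
        by (rule continuous_on_mult)
      moreover have "(Psi x k i j * ?E x) * exp (\<i> * of_real (k * x * sig mp j)) = Psi x k i j" for x
        by (rule mult_phase_cancel)
      ultimately show ?c by (simp only:)
    next
      assume ?c
      thus ?c' by (intro continuous_intros)
    qed
    have eq: "exp (\<i> * of_real (k * (sig mp j - sig mp i) * (y - x))) *
                (\<Sum>l<n. cutoff n Q y i l * (Psi y k l j * ?E y))
      = ?E x * (exp (- \<i> * of_real (k * (y - x) * sig mp i)) * (\<Sum>l<n. Q y i l * Psi y k l j))" for x y
    proof -
      have 1: "(\<Sum>l<n. cutoff n Q y i l * (Psi y k l j * ?E y)) = ?E y * (\<Sum>l<n. Q y i l * Psi y k l j)"
        using i by (simp add: cutoff_def sum_distrib_left sum_distrib_right mult_ac)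
      have 2: "exp (\<i> * of_real (k * (sig mp j - sig mp i) * (y - x))) * ?E y
          = ?E x * exp (- \<i> * of_real (k * (y - x) * sig mp i))"
        by (simp add: exp_add[symmetric] algebra_simps)
      show ?thesis unfolding 1 by (simp only: mult.assoc[symmetric] 2)
    qed
    have i: "?i x \<longleftrightarrow> ?i' x" for x
      unfolding eq using E(1)[of x] by (simp only: set_integrable_mult_right_iff simp_thms)
    have v: "?v x \<longleftrightarrow> ?v' x" for x
    proof -
      define I where "I = (LINT y:{x..}|lborel. exp (- \<i> * of_real (k * (y - x) * sig mp i)) *
                    (\<Sum>l<n. Q y i l * Psi y k l j))"
      \<comment> \<open>Both sides are 0 for i \<noteq> j, and for i = j the two phases
        cancel.\<close>
      have "idm i j = idm i j * exp (\<i> * of_real (k * x * sig mp i)) * ?E x"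
        using E(2)[of x] by (auto simp: idm_def)
      hence "?v' x \<longleftrightarrow> Psi x k i j * ?E x = (idm i j * exp (\<i> * of_real (k * x * sig mp i)) - I) * ?E x"
        unfolding eq set_integral_mult_right I_def[symmetric] left_diff_distrib by (simp only: mult.commute)
      thus ?thesis unfolding I_def[symmetric] mult_right_cancel[OF E(1)] by blast
    qed
    show ?thesis unfolding i v c ..
  qed
  have swap: "(\<forall>k. \<forall>i<n. \<forall>j<n. P k i j) \<longleftrightarrow> (\<forall>k. \<forall>j<n. \<forall>i<n. P' k i j)"
    if "\<And>i j k. i < n \<Longrightarrow> j < n \<Longrightarrow> P k i j \<longleftrightarrow> P' k i j" for P P' :: "real \<Rightarrow> nat \<Rightarrow> nat \<Rightarrow> bool"
    using that by blast
  show ?thesis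
    unfolding is_jost_psi_def volterra_sol_def n_def[symmetric]
    by (rule conj_cong[OF refl], rule swap, rule entry)
qed

lemma volterra_sol_cong:
  assumes eq: "\<And>i x. i < n \<Longrightarrow> m i x = m' i x"
  shows "volterra_sol n A c v m \<longleftrightarrow> volterra_sol n A c v m'"
proof -
  have "m i = m' i" if "i < n" for i using eq[OF that] by auto
  moreover have "(\<Sum>l<n. A y i l * m l y) = (\<Sum>l<n. A y i l * m' l y)" for y i
    by (simp add: eq)
  ultimately show ?thesis unfolding volterra_sol_def by simp
qed

text \<open>This gives meaning to the description operator in \<open>jost_psi\<close>. Existence and
  uniqueness are those of the column equations; outside the matrix range the zero convention fixes
  the values.\<close>

lemma ex1_jost_psi:
  assumes Q: "admissible_pot mp mm Q"
  shows "\<exists>!Psi. is_jost_psi mp mm Q Psi"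
proof -
  let ?n = "dimn mp mm"
  have "\<exists>S. \<forall>k. volterra_sol ?n (cutoff ?n Q) (\<lambda>i. k * (sig mp j - sig mp i)) (\<lambda>i. idm i j) (S k)"
    if "j < ?n" for j by (rule column_solution[OF Q that]) blast
  then obtain S where S: "\<And>j k. j < ?n \<Longrightarrow>
      volterra_sol ?n (cutoff ?n Q) (\<lambda>i. k * (sig mp j - sig mp i)) (\<lambda>i. idm i j) (S j k)"
    by metis
  define Psi where "Psi x k i j = (if i < ?n \<and> j < ?n then S j k i x * exp (\<i> * of_real (k * x * sig mp j)) else 0)"
    for x k i j
  show ?thesis
  proof (rule ex1I[of _ Psi])
    have "volterra_sol ?n (cutoff ?n Q) (\<lambda>i. k * (sig mp j - sig mp i)) (\<lambda>i. idm i j)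
      (\<lambda>i x. Psi x k i j * exp (- \<i> * of_real (k * x * sig mp j)))" if "j < ?n" for j k
    proof -
      have eq: "Psi x k i j * exp (- \<i> * of_real (k * x * sig mp j)) = S j k i x" if "i < ?n" for i x
        using that \<open>j < ?n\<close> by (simp add: Psi_def mult.assoc exp_add[symmetric])
      show ?thesis by (rule iffD2[OF volterra_sol_cong[OF eq] S[OF that]])
    qed
    thus "is_jost_psi mp mm Q Psi"
      unfolding is_jost_psi_iff by (auto simp: Psi_def)
  next
    fix P assume P: "is_jost_psi mp mm Q P"
    have "P x k i j = Psi x k i j" for x k i j
    proof (cases "i < ?n \<and> j < ?n")
      case True
      interpret akns_column ?n j "\<lambda>i. sig mp j - sig mp i" "cutoff ?n Q"
        using True by (intro akns_column_cutoff[OF Q]) simp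
      have "P x k i j * exp (- \<i> * of_real (k * x * sig mp j)) = S j k i x"
        using P True S by (intro volterra_sol_unique) (auto simp: is_jost_psi_iff)
      from this[symmetric] have "S j k i x * exp (\<i> * of_real (k * x * sig mp j)) = P x k i j"
        by (simp only: mult_phase_cancel)
      thus ?thesis using True by (simp add: Psi_def)
    next
      case False
      thus ?thesis using P by (auto simp: Psi_def is_jost_psi_def)
    qed
    thus "P = Psi" by (simp add: fun_eq_iff)
  qed
qed

text \<open>The columns of \<open>faddeev_M\<close> and the Picard series solve the same column
  equation, so uniqueness transfers the Fourier representation.\<close>

lemma faddeev_M_eq_fourier:
  assumes Q: "admissible_pot mp mm Q" and j: "j < dimn mp mm"
  obtains kern B where
    "\<And>k i x. i < dimn mp mm \<Longrightarrow>
      faddeev_M mp mm Q x k i j = idm i j + (\<integral>t. exp (\<i> * of_real (k * t)) * kern i x t \<partial>lborel)"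
    "\<And>i x. i < dimn mp mm \<Longrightarrow> integrable lborel (kern i x)"
    "\<And>i x. i < dimn mp mm \<Longrightarrow> (\<integral>t. norm (kern i x t) \<partial>lborel) \<le> B"
    "\<And>i x t. j < mp \<Longrightarrow> t < 0 \<Longrightarrow> kern i x t = 0"
    "\<And>i x t. mp < j \<Longrightarrow> t > 0 \<Longrightarrow> kern i x t = 0"
proof (rule column_solution[OF Q j], goal_cases)
  case (1 S kern B)
  interpret akns_column "dimn mp mm" j "\<lambda>i. sig mp j - sig mp i" "cutoff (dimn mp mm) Q"
    by (rule akns_column_cutoff[OF Q j])
  have "is_jost_psi mp mm Q (jost_psi mp mm Q)"
    unfolding jost_psi_def by (rule theI'[OF ex1_jost_psi[OF Q]])
  hence "volterra_sol (dimn mp mm) (cutoff (dimn mp mm) Q) (\<lambda>i. k * (sig mp j - sig mp i)) (\<lambda>i. idm i j)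
      (\<lambda>i x. faddeev_M mp mm Q x k i j)" for k
    unfolding is_jost_psi_iff faddeev_M_def using j by blast
  hence "faddeev_M mp mm Q x k i j = S k i x" if "i < dimn mp mm" for k i x
    using 1(2)[of k] that by (rule volterra_sol_unique)
  thus ?case using 1 by (intro that[of kern B]) simp_all
qed

section \<open>Substitutions on half-lines and the column norm\<close>

lemma set_integral_atMost_reflect:
  fixes f :: "real \<Rightarrow> 'a :: {banach, second_countable_topology}"
  shows "(LINT y:{..x}|lborel. f y) = (LINT y:{-x..}|lborel. f (- y))"
    and "set_integrable lborel {..x} f \<longleftrightarrow> set_integrable lborel {-x..} (\<lambda>y. f (- y))"
proof -
  have eq: "indicat_real {..x} (0 + (- 1) * y) *\<^sub>R f (0 + (- 1) * y) = indicat_real {-x..} y *\<^sub>R f (- y)" for y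
    by (auto split: split_indicator)
  show "(LINT y:{..x}|lborel. f y) = (LINT y:{-x..}|lborel. f (- y))"
    using lborel_integral_real_affine[of "-1" "\<lambda>y. indicat_real {..x} y *\<^sub>R f y" 0]
    unfolding eq set_lebesgue_integral_def by simp
  show "set_integrable lborel {..x} f \<longleftrightarrow> set_integrable lborel {-x..} (\<lambda>y. f (- y))"
    using lborel_integrable_real_affine_iff[of "-1" "\<lambda>y. indicat_real {..x} y *\<^sub>R f y" 0]
    unfolding eq set_integrable_def by simp
qed

text \<open>The substitution t = s (y - x) with unit Jacobian passes from the dual variable t of k
  to the spatial variable y, where the support of f becomes the range y \<ge> x.\<close>

lemma set_integral_half_line:
  fixes f :: "real \<Rightarrow> 'a :: {banach, second_countable_topology}"
  assumes s: "s = 1 \<or> s = - 1" and supp: "\<And>t. s * t < 0 \<Longrightarrow> f t = 0"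
  shows "(LINT y:{x..}|lborel. f (s * (y - x))) = (\<integral>t. f t \<partial>lborel)"
    and "set_integrable lborel {x..} (\<lambda>y. f (s * (y - x))) \<longleftrightarrow> integrable lborel f"
proof -
  have eq: "(\<lambda>y. indicat_real {x..} y *\<^sub>R f (s * (y - x))) = (\<lambda>y. f (- s * x + s * y))"
    using s supp by (auto simp: fun_eq_iff algebra_simps split: split_indicator)
  have "s \<noteq> 0" "\<bar>s\<bar> = 1" using s by auto
  thus "(LINT y:{x..}|lborel. f (s * (y - x))) = (\<integral>t. f t \<partial>lborel)"
    and "set_integrable lborel {x..} (\<lambda>y. f (s * (y - x))) \<longleftrightarrow> integrable lborel f"
    unfolding set_lebesgue_integral_def set_integrable_def eq
    using lborel_integral_real_affine[of s f "- s * x"] lborel_integrable_real_affine_iff[of s f "- s * x"]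
    by simp_all
qed

text \<open>The column norm is a Euclidean norm of the entries, hence at most their l1 norm. This
  reduces its bounds to bounds on single entries.\<close>

lemma colnorm_le_sum: "colnorm n C A \<le> (\<Sum>i<n. \<Sum>j\<in>C. cmod (A i j))"
proof -
  have "colnorm n C A = L2_set (\<lambda>(i, j). cmod (A i j)) ({..<n} \<times> C)"
    unfolding colnorm_def L2_set_def by (simp add: sum.cartesian_product case_prod_unfold)
  also have "\<dots> \<le> (\<Sum>(i, j)\<in>{..<n} \<times> C. cmod (A i j))"
    by (rule L2_set_le_sum) auto
  finally show ?thesis by (simp add: sum.cartesian_product)
qed

lemma set_integral_colnorm_le:
  assumes int: "\<And>i j. i < n \<Longrightarrow> j \<in> C \<Longrightarrow> set_integrable lborel S (\<lambda>y. G y i j)"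
    and le: "\<And>i j. i < n \<Longrightarrow> j \<in> C \<Longrightarrow> (LINT y:S|lborel. cmod (G y i j)) \<le> b j"
  shows "set_integrable lborel S (\<lambda>y. colnorm n C (G y))"
    and "(LINT y:S|lborel. colnorm n C (G y)) \<le> (\<Sum>i<n. \<Sum>j\<in>C. b j)"
proof -
  \<comment> \<open>Set integrability controls G only on S, so the indicator is absorbed into H to
    have measurability on the whole line.\<close>
  define H where "H y i j = indicat_real S y *\<^sub>R G y i j" for y i j
  have eq: "(\<lambda>y. indicat_real S y *\<^sub>R colnorm n C (G y)) = (\<lambda>y. colnorm n C (H y))"
    by (auto simp: H_def colnorm_def fun_eq_iff split: split_indicator)
  have H: "integrable lborel (\<lambda>y. H y i j)" if "i < n" "j \<in> C" for i j
    using int[OF that] by (simp add: H_def set_integrable_def)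
  have nH: "(\<lambda>y. indicat_real S y *\<^sub>R cmod (G y i j)) = (\<lambda>y. cmod (H y i j))" for i j
    by (auto simp: H_def fun_eq_iff split: split_indicator)
  have sum: "integrable lborel (\<lambda>y. \<Sum>i<n. \<Sum>j\<in>C. cmod (H y i j))"
    by (intro Bochner_Integration.integrable_sum integrable_norm H) auto
  have [measurable]: "(\<lambda>y. colnorm n C (H y)) \<in> borel_measurable borel"
    unfolding colnorm_def
    using H[THEN borel_measurable_integrable]
    by (intro measurable_compose[OF _ borel_measurable_sqrt] borel_measurable_sum borel_measurable_power borel_measurable_norm) auto
  have nonneg: "0 \<le> colnorm n C A" for A unfolding colnorm_def by (intro real_sqrt_ge_zero sum_nonneg) auto
  have "integrable lborel (\<lambda>y. colnorm n C (H y))"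
    by (rule Bochner_Integration.integrable_bound[OF sum])
      (auto simp: nonneg intro!: order_trans[OF colnorm_le_sum])
  thus "set_integrable lborel S (\<lambda>y. colnorm n C (G y))"
    unfolding set_integrable_def eq .
  have "(LINT y:S|lborel. colnorm n C (G y)) \<le> (\<integral>y. (\<Sum>i<n. \<Sum>j\<in>C. cmod (H y i j)) \<partial>lborel)"
    unfolding set_lebesgue_integral_def eq by (rule integral_mono) (fact+, rule colnorm_le_sum)
  also have "\<dots> = (\<Sum>i<n. \<Sum>j\<in>C. \<integral>y. cmod (H y i j) \<partial>lborel)"
  proof (subst Bochner_Integration.integral_sum)
    show "integrable lborel (\<lambda>y. \<Sum>j\<in>C. cmod (H y i j))" if "i \<in> {..<n}" for i
      using that by (intro Bochner_Integration.integrable_sum integrable_norm H) auto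
    show "(\<Sum>i<n. \<integral>y. (\<Sum>j\<in>C. cmod (H y i j)) \<partial>lborel) = (\<Sum>i<n. \<Sum>j\<in>C. \<integral>y. cmod (H y i j) \<partial>lborel)"
      by (intro sum.cong refl Bochner_Integration.integral_sum integrable_norm H) auto
  qed
  also have "\<dots> \<le> (\<Sum>i<n. \<Sum>j\<in>C. b j)"
    using le unfolding set_lebesgue_integral_def nH by (intro sum_mono) auto
  finally show "(LINT y:S|lborel. colnorm n C (G y)) \<le> (\<Sum>i<n. \<Sum>j\<in>C. b j)" .
qed

text \<open>The kernel in t lives on t \<ge> 0 for plus columns and on t \<le> 0 for minus columns;
  putting t = y - x or t = x - y makes it a kernel over y \<ge> x. The bound is uniform in x because
  the kernel bounds are.\<close>

lemma faddeev_M_triangular_kernel: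
  fixes mp mm :: nat
  defines "n \<equiv> dimn mp mm"
  assumes Q: "admissible_pot mp mm Q"
  shows "\<exists>K B. (\<forall>x k. \<forall>i<n.
       (\<forall>j\<in>plus_cols mp.
          set_integrable lborel {x..} (\<lambda>y. exp (\<i> * of_real (k * (y - x))) * K x y i j) \<and>
          faddeev_M mp mm Q x k i j = idm i j +
            (LINT y:{x..}|lborel. exp (\<i> * of_real (k * (y - x))) * K x y i j)) \<and>
       (\<forall>j\<in>minus_cols mp mm.
          set_integrable lborel {x..} (\<lambda>y. exp (- \<i> * of_real (k * (y - x))) * K x y i j) \<and>
          faddeev_M mp mm Q x k i j = idm i j +
            (LINT y:{x..}|lborel. exp (- \<i> * of_real (k * (y - x))) * K x y i j))) \<and>
    (\<forall>x. \<forall>Cs\<in>{plus_cols mp, minus_cols mp mm}.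
         set_integrable lborel {x..} (\<lambda>y. colnorm n Cs (K x y)) \<and>
         (LINT y:{x..}|lborel. colnorm n Cs (K x y)) \<le> B)"
proof -
  \<comment> \<open>All properties of one column are packed into one predicate, so that choice
    yields kernels and bounds for all columns at once.\<close>
  define P where "P j kern B \<longleftrightarrow> (\<forall>k x. \<forall>i<n.
      faddeev_M mp mm Q x k i j = idm i j + (\<integral>t. exp (\<i> * of_real (k * t)) * kern i x t \<partial>lborel)) \<and>
      (\<forall>x. \<forall>i<n. integrable lborel (kern i x) \<and> (\<integral>t. norm (kern i x t) \<partial>lborel) \<le> B) \<and>
      (\<forall>i x t. j < mp \<longrightarrow> t < 0 \<longrightarrow> kern i x t = 0) \<and> (\<forall>i x t. mp < j \<longrightarrow> t > 0 \<longrightarrow> kern i x t = 0)"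
    for j B and kern :: "nat \<Rightarrow> real \<Rightarrow> real \<Rightarrow> complex"
  have "\<exists>kern B. P j kern B" if "j < n" for j
    by (rule faddeev_M_eq_fourier[OF Q that[unfolded n_def]]) (unfold P_def n_def, blast)
  then obtain kern B where P: "\<And>j. j < n \<Longrightarrow> P j (kern j) (B j)" by metis
  have M: "faddeev_M mp mm Q x k i j = idm i j + (\<integral>t. exp (\<i> * of_real (k * t)) * kern j i x t \<partial>lborel)"
    and int: "integrable lborel (kern j i x)"
    and bound: "(\<integral>t. norm (kern j i x t) \<partial>lborel) \<le> B j"
    if "j < n" "i < n" for j k x i
    using P[OF that(1)] that(2) unfolding P_def by blast+
  have supp: "j < mp \<Longrightarrow> t < 0 \<Longrightarrow> kern j i x t = 0" "mp < j \<Longrightarrow> t > 0 \<Longrightarrow> kern j i x t = 0"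
    if "j < n" for j i x t
    using P[OF that] unfolding P_def by blast+
  \<comment> \<open>The sign of the half-line carrying the kernel of column j. The value at
    \<open>mp\<close> is a default; \<open>cols\<close> excludes the middle column.\<close>
  define s :: "nat \<Rightarrow> real" where "s j = (if j < mp then 1 else - 1)" for j
  define K where "K x y i j = kern j i x (s j * (y - x))" for x y i j
  have s: "s j = 1 \<or> s j = - 1" for j by (simp add: s_def)
  have supp': "kern j i x t = 0" if "j < n" "j \<noteq> mp" "s j * t < 0" for i j x t
    using that supp[OF that(1)] by (cases "j < mp") (auto simp: s_def)
  have nK: "set_integrable lborel {x..} (\<lambda>y. K x y i j)"
    and bK: "(LINT y:{x..}|lborel. norm (K x y i j)) \<le> B j"
    if "j < n" "j \<noteq> mp" "i < n" for i j x
    using set_integral_half_line[OF s, of j "kern j i x" x] supp'[OF that(1,2)] int[OF that(1,3), of x]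
      set_integral_half_line[OF s, of j "\<lambda>t. norm (kern j i x t)" x] bound[OF that(1,3), of x]
    unfolding K_def by simp_all
  have eK: "set_integrable lborel {x..} (\<lambda>y. exp (\<i> * of_real (k * (s j * (y - x)))) * K x y i j)"
    and MK: "faddeev_M mp mm Q x k i j = idm i j +
      (LINT y:{x..}|lborel. exp (\<i> * of_real (k * (s j * (y - x)))) * K x y i j)"
    if "j < n" "j \<noteq> mp" "i < n" for i j x k
  proof -
    define f where "f t = exp (\<i> * complex_of_real (k * t)) * kern j i x t" for t
    have f: "s j * t < 0 \<Longrightarrow> f t = 0" for t using supp'[OF that(1,2)] by (simp add: f_def)
    have "integrable lborel f" unfolding f_def
      by (rule Bochner_Integration.integrable_bound[OF int[OF that(1,3), of x]])
        (use int[OF that(1,3), of x, THEN borel_measurable_integrable] in \<open>simp_all add: norm_mult\<close>)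
    thus "set_integrable lborel {x..} (\<lambda>y. exp (\<i> * of_real (k * (s j * (y - x)))) * K x y i j)"
      using set_integral_half_line(2)[of "s j" f x, OF s f] unfolding f_def K_def by blast
    show "faddeev_M mp mm Q x k i j = idm i j +
      (LINT y:{x..}|lborel. exp (\<i> * of_real (k * (s j * (y - x)))) * K x y i j)"
      using set_integral_half_line(1)[of "s j" f x, OF s f] M[OF that(1,3), of x k] unfolding f_def K_def by simp
  qed
  have cols: "j < n \<and> j \<noteq> mp" if "j \<in> plus_cols mp \<or> j \<in> minus_cols mp mm" for j
    using that by (auto simp: plus_cols_def minus_cols_def n_def dimn_def)
  have s_plus: "s j = 1" if "j \<in> plus_cols mp" for j using that by (simp add: s_def plus_cols_def)
  have s_minus: "s j = - 1" if "j \<in> minus_cols mp mm" for j using that by (simp add: s_def minus_cols_def)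
  have minus: "\<i> * of_real (k * (- 1 * r)) = - \<i> * of_real (k * r)" for k r :: real by simp
  define b where "b Cs = (\<Sum>i<n. \<Sum>j\<in>Cs. B j)" for Cs
  let ?B = "max (b (plus_cols mp)) (b (minus_cols mp mm))"
  show ?thesis
  proof (intro exI[of _ K] exI[of _ ?B] conjI allI impI ballI)
    fix x k i j assume i: "i < n" and j: "j \<in> plus_cols mp"
    note c = cols[OF disjI1[OF j], THEN conjunct1] cols[OF disjI1[OF j], THEN conjunct2]
    show "set_integrable lborel {x..} (\<lambda>y. exp (\<i> * of_real (k * (y - x))) * K x y i j)"
      "faddeev_M mp mm Q x k i j = idm i j +
         (LINT y:{x..}|lborel. exp (\<i> * of_real (k * (y - x))) * K x y i j)"
      using eK[OF c i, of x k] MK[OF c i, of x k] unfolding s_plus[OF j] mult_1 by blast+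
  next
    fix x k i j assume i: "i < n" and j: "j \<in> minus_cols mp mm"
    note c = cols[OF disjI2[OF j], THEN conjunct1] cols[OF disjI2[OF j], THEN conjunct2]
    show "set_integrable lborel {x..} (\<lambda>y. exp (- \<i> * of_real (k * (y - x))) * K x y i j)"
      "faddeev_M mp mm Q x k i j = idm i j +
         (LINT y:{x..}|lborel. exp (- \<i> * of_real (k * (y - x))) * K x y i j)"
      using eK[OF c i, of x k] MK[OF c i, of x k] unfolding s_minus[OF j] minus by blast+
  next
    fix x Cs assume Cs: "Cs \<in> {plus_cols mp, minus_cols mp mm}"
    hence "j < n" "j \<noteq> mp" if "j \<in> Cs" for j using cols[of j] that by auto
    note * = set_integral_colnorm_le[OF nK bK, OF this(1) this(2) _ this(1) this(2)]
    show "set_integrable lborel {x..} (\<lambda>y. colnorm n Cs (K x y))" by (rule *) auto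
    have "(LINT y:{x..}|lborel. colnorm n Cs (K x y)) \<le> b Cs"
      unfolding b_def by (rule *) auto
    also have "\<dots> \<le> ?B" using Cs by auto
    finally show "(LINT y:{x..}|lborel. colnorm n Cs (K x y)) \<le> ?B" .
  qed
qed

section \<open>Reflection: from \<Phi> to \<Psi>\<close>

text \<open>If v solves the system for Q at -k, then v(-x) solves it for this potential at k: the
  sign comes from the chain rule, and the change of k restores the term ik\<Sigma>.\<close>

definition reflect :: "(real \<Rightarrow> nat \<Rightarrow> nat \<Rightarrow> complex) \<Rightarrow> real \<Rightarrow> nat \<Rightarrow> nat \<Rightarrow> complex" where
  "reflect Q x i j = - Q (- x) i j"

lemma admissible_pot_reflect:
  assumes "admissible_pot mp mm Q"
  shows "admissible_pot mp mm (reflect Q)"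
proof -
  have "integrable lborel (\<lambda>x. reflect Q x i j)" if "i < dimn mp mm" "j < dimn mp mm" for i j
    using lborel_integrable_real_affine[of "\<lambda>x. Q x i j" "-1" 0] assms that
    by (simp add: reflect_def admissible_pot_def)
  thus ?thesis using assms by (simp add: reflect_def admissible_pot_def)
qed

text \<open>Negating x, y and k carries the integral from -\<infinity> to a tail integral, while the
  free factor depends only on the product k x and is unchanged. The sign in \<open>reflect\<close>
  accounts for the minus before the integral.\<close>

lemma is_jost_phi_iff_reflect:
  "is_jost_phi mp mm Q Phi \<longleftrightarrow> is_jost_psi mp mm (reflect Q) (\<lambda>x k. Phi (- x) (- k))"
proof -
  have all: "(\<forall>x::real. P x) \<longleftrightarrow> (\<forall>x. P (- x))" for P by (metis minus_minus)
  have cont: "continuous_on UNIV f \<longleftrightarrow> continuous_on UNIV (\<lambda>x. f (- x))" for f :: "real \<Rightarrow> complex"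
  proof
    assume "continuous_on UNIV f"
    thus "continuous_on UNIV (\<lambda>x. f (- x))"
      by (rule continuous_on_compose2) (auto intro: continuous_intros)
  next
    assume "continuous_on UNIV (\<lambda>x. f (- x))"
    hence "continuous_on UNIV (\<lambda>x. f (- (- x)))"
      by (rule continuous_on_compose2) (auto intro: continuous_intros)
    thus "continuous_on UNIV f" by simp
  qed
  let ?n = "dimn mp mm"
  have eq: "exp (\<i> * of_real (- k * (- x - - y) * sig mp i)) * (\<Sum>l<?n. Q (- y) i l * Phi (- y) (- k) l j)
    = - (exp (- \<i> * of_real (k * (y - x) * sig mp i)) * (\<Sum>l<?n. reflect Q y i l * Phi (- y) (- k) l j))"
    for k x y i j
  proof -
    have "\<i> * complex_of_real (- k * (- x - - y) * sig mp i) = - \<i> * of_real (k * (y - x) * sig mp i)"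
      by (simp add: algebra_simps)
    thus ?thesis by (simp only: reflect_def sum_negf mult_minus_left mult_minus_right minus_minus)
  qed
  have neg: "set_integrable lborel S (\<lambda>y. - f y) \<longleftrightarrow> set_integrable lborel S f"
    "(LINT y:S|lborel. - f y) = - (LINT y:S|lborel. f y)" for S and f :: "real \<Rightarrow> complex"
    by (simp_all add: set_lebesgue_integral_def set_integrable_def)
  have "(continuous_on UNIV (\<lambda>x. Phi x (- k) i j) \<and>
       (\<forall>x. set_integrable lborel {..x}
              (\<lambda>y. exp (\<i> * of_real (- k * (x - y) * sig mp i)) *
                    (\<Sum>l<?n. Q y i l * Phi y (- k) l j)) \<and>
            Phi x (- k) i j = idm i j * exp (\<i> * of_real (- k * x * sig mp i))
              + (LINT y:{..x}|lborel. exp (\<i> * of_real (- k * (x - y) * sig mp i)) *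
                    (\<Sum>l<?n. Q y i l * Phi y (- k) l j))))
    \<longleftrightarrow> (continuous_on UNIV (\<lambda>x. Phi (- x) (- k) i j) \<and>
       (\<forall>x. set_integrable lborel {x..}
              (\<lambda>y. exp (- \<i> * of_real (k * (y - x) * sig mp i)) *
                    (\<Sum>l<?n. reflect Q y i l * Phi (- y) (- k) l j)) \<and>
            Phi (- x) (- k) i j = idm i j * exp (\<i> * of_real (k * x * sig mp i))
              - (LINT y:{x..}|lborel. exp (- \<i> * of_real (k * (y - x) * sig mp i)) *
                    (\<Sum>l<?n. reflect Q y i l * Phi (- y) (- k) l j))))" for k i j
    by (subst cont, subst all, simp only: set_integral_atMost_reflect minus_minus eq neg
        minus_mult_minus add_uminus_conv_diff)
  hence "(\<forall>k. \<forall>i<?n. \<forall>j<?n. continuous_on UNIV (\<lambda>x. Phi x k i j) \<and>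
       (\<forall>x. set_integrable lborel {..x}
              (\<lambda>y. exp (\<i> * of_real (k * (x - y) * sig mp i)) *
                    (\<Sum>l<?n. Q y i l * Phi y k l j)) \<and>
            Phi x k i j = idm i j * exp (\<i> * of_real (k * x * sig mp i))
              + (LINT y:{..x}|lborel. exp (\<i> * of_real (k * (x - y) * sig mp i)) *
                    (\<Sum>l<?n. Q y i l * Phi y k l j))))
    \<longleftrightarrow> (\<forall>k. \<forall>i<?n. \<forall>j<?n. continuous_on UNIV (\<lambda>x. Phi (- x) (- k) i j) \<and>
       (\<forall>x. set_integrable lborel {x..}
              (\<lambda>y. exp (- \<i> * of_real (k * (y - x) * sig mp i)) *
                    (\<Sum>l<?n. reflect Q y i l * Phi (- y) (- k) l j)) \<and>
            Phi (- x) (- k) i j = idm i j * exp (\<i> * of_real (k * x * sig mp i))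
              - (LINT y:{x..}|lborel. exp (- \<i> * of_real (k * (y - x) * sig mp i)) *
                    (\<Sum>l<?n. reflect Q y i l * Phi (- y) (- k) l j))))"
    by (subst all) (simp only:)
  moreover have "(\<forall>x k i j. \<not> (i < ?n \<and> j < ?n) \<longrightarrow> Phi x k i j = 0)
    \<longleftrightarrow> (\<forall>x k i j. \<not> (i < ?n \<and> j < ?n) \<longrightarrow> Phi (- x) (- k) i j = 0)"
    by (metis minus_minus)
  ultimately show ?thesis unfolding is_jost_phi_def is_jost_psi_def by (simp only:)
qed

text \<open>The equivalence with the reflected problem transports existence and uniqueness, so the
  description operator in \<open>jost_phi\<close> selects the reflected \<open>jost_psi\<close>. The
  normalizing phases agree because they involve only k x.\<close>

lemma faddeev_N_eq_reflect:
  assumes "admissible_pot mp mm Q"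
  shows "faddeev_N mp mm Q x k = faddeev_M mp mm (reflect Q) (- x) (- k)"
proof -
  let ?P = "jost_psi mp mm (reflect Q)"
  have ex1: "\<exists>!Psi. is_jost_psi mp mm (reflect Q) Psi"
    by (rule ex1_jost_psi[OF admissible_pot_reflect[OF assms]])
  hence P: "is_jost_psi mp mm (reflect Q) ?P" unfolding jost_psi_def by (rule theI')
  have "jost_phi mp mm Q = (\<lambda>x k. ?P (- x) (- k))"
    unfolding jost_phi_def
  proof (rule the_equality)
    show "is_jost_phi mp mm Q (\<lambda>x k. ?P (- x) (- k))"
      using P by (simp add: is_jost_phi_iff_reflect)
  next
    fix Phi assume "is_jost_phi mp mm Q Phi"
    hence "(\<lambda>x k. Phi (- x) (- k)) = ?P"
      using ex1 P unfolding is_jost_phi_iff_reflect by blast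
    hence "Phi (- x) (- k) = ?P x k" for x k by metis
    from this[of "- _" "- _"] show "Phi = (\<lambda>x k. ?P (- x) (- k))" by (simp add: fun_eq_iff)
  qed
  thus ?thesis by (simp add: fun_eq_iff faddeev_N_def faddeev_M_def)
qed

theorem theorem2p1:
  fixes mp mm :: nat and Q :: "real \<Rightarrow> nat \<Rightarrow> nat \<Rightarrow> complex"
  assumes "mp \<ge> 1" and "mm \<ge> 1" and "admissible_pot mp mm Q"
  shows "\<exists>K J :: real \<Rightarrow> real \<Rightarrow> nat \<Rightarrow> nat \<Rightarrow> complex.
    (\<forall>x k. \<forall>i<dimn mp mm.
       (\<forall>j\<in>plus_cols mp.
          set_integrable lborel {x..} (\<lambda>y. exp (\<i> * of_real (k * (y - x))) * K x y i j) \<and>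
          faddeev_M mp mm Q x k i j = idm i j +
            (LINT y:{x..}|lborel. exp (\<i> * of_real (k * (y - x))) * K x y i j)) \<and>
       (\<forall>j\<in>minus_cols mp mm.
          set_integrable lborel {x..} (\<lambda>y. exp (- \<i> * of_real (k * (y - x))) * K x y i j) \<and>
          faddeev_M mp mm Q x k i j = idm i j +
            (LINT y:{x..}|lborel. exp (- \<i> * of_real (k * (y - x))) * K x y i j)) \<and>
       (\<forall>j\<in>plus_cols mp.
          set_integrable lborel {..x} (\<lambda>y. exp (- \<i> * of_real (k * (x - y))) * J x y i j) \<and>
          faddeev_N mp mm Q x k i j = idm i j +
            (LINT y:{..x}|lborel. exp (- \<i> * of_real (k * (x - y))) * J x y i j)) \<and>
       (\<forall>j\<in>minus_cols mp mm.
          set_integrable lborel {..x} (\<lambda>y. exp (\<i> * of_real (k * (x - y))) * J x y i j) \<and>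
          faddeev_N mp mm Q x k i j = idm i j +
            (LINT y:{..x}|lborel. exp (\<i> * of_real (k * (x - y))) * J x y i j))) \<and>
    (\<forall>x. set_integrable lborel {x..} (\<lambda>y. colnorm (dimn mp mm) (plus_cols mp) (K x y)) \<and>
         set_integrable lborel {..x} (\<lambda>y. colnorm (dimn mp mm) (plus_cols mp) (J x y)) \<and>
         set_integrable lborel {x..} (\<lambda>y. colnorm (dimn mp mm) (minus_cols mp mm) (K x y)) \<and>
         set_integrable lborel {..x} (\<lambda>y. colnorm (dimn mp mm) (minus_cols mp mm) (J x y))) \<and>
    (\<exists>C. \<forall>x.
       (LINT y:{x..}|lborel. colnorm (dimn mp mm) (plus_cols mp) (K x y)) +
       (LINT y:{..x}|lborel. colnorm (dimn mp mm) (plus_cols mp) (J x y)) \<le> C \<and>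
       (LINT y:{x..}|lborel. colnorm (dimn mp mm) (minus_cols mp mm) (K x y)) +
       (LINT y:{..x}|lborel. colnorm (dimn mp mm) (minus_cols mp mm) (J x y)) \<le> C)"
proof -
  let ?n = "dimn mp mm"
  obtain K B where K: "\<forall>x k. \<forall>i<?n.
       (\<forall>j\<in>plus_cols mp.
          set_integrable lborel {x..} (\<lambda>y. exp (\<i> * of_real (k * (y - x))) * K x y i j) \<and>
          faddeev_M mp mm Q x k i j = idm i j +
            (LINT y:{x..}|lborel. exp (\<i> * of_real (k * (y - x))) * K x y i j)) \<and>
       (\<forall>j\<in>minus_cols mp mm.
          set_integrable lborel {x..} (\<lambda>y. exp (- \<i> * of_real (k * (y - x))) * K x y i j) \<and>
          faddeev_M mp mm Q x k i j = idm i j +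
            (LINT y:{x..}|lborel. exp (- \<i> * of_real (k * (y - x))) * K x y i j))"
    and B: "\<forall>x. \<forall>Cs\<in>{plus_cols mp, minus_cols mp mm}.
         set_integrable lborel {x..} (\<lambda>y. colnorm ?n Cs (K x y)) \<and>
         (LINT y:{x..}|lborel. colnorm ?n Cs (K x y)) \<le> B"
    using faddeev_M_triangular_kernel[OF assms(3)] by blast
  \<comment> \<open>The reflected potential supplies the kernel for N.\<close>
  obtain K' B' where K': "\<forall>x k. \<forall>i<?n.
       (\<forall>j\<in>plus_cols mp.
          set_integrable lborel {x..} (\<lambda>y. exp (\<i> * of_real (k * (y - x))) * K' x y i j) \<and>
          faddeev_M mp mm (reflect Q) x k i j = idm i j +
            (LINT y:{x..}|lborel. exp (\<i> * of_real (k * (y - x))) * K' x y i j)) \<and>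
       (\<forall>j\<in>minus_cols mp mm.
          set_integrable lborel {x..} (\<lambda>y. exp (- \<i> * of_real (k * (y - x))) * K' x y i j) \<and>
          faddeev_M mp mm (reflect Q) x k i j = idm i j +
            (LINT y:{x..}|lborel. exp (- \<i> * of_real (k * (y - x))) * K' x y i j))"
    and B': "\<forall>x. \<forall>Cs\<in>{plus_cols mp, minus_cols mp mm}.
         set_integrable lborel {x..} (\<lambda>y. colnorm ?n Cs (K' x y)) \<and>
         (LINT y:{x..}|lborel. colnorm ?n Cs (K' x y)) \<le> B'"
    using faddeev_M_triangular_kernel[OF admissible_pot_reflect[OF assms(3)]] by blast
  define J where "J x y = K' (- x) (- y)" for x y
  \<comment> \<open>Negating both k and the space variables turns the phases of the columns of M
    into those required for N.\<close>
  have phase: "\<i> * of_real (- k * (y - - x)) = - \<i> * of_real (k * (x - - y))"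
    "- \<i> * of_real (- k * (y - - x)) = \<i> * of_real (k * (x - - y))" for k x y :: real
    by (simp_all add: algebra_simps)
  have J: "(\<forall>j\<in>plus_cols mp.
          set_integrable lborel {..x} (\<lambda>y. exp (- \<i> * of_real (k * (x - y))) * J x y i j) \<and>
          faddeev_N mp mm Q x k i j = idm i j +
            (LINT y:{..x}|lborel. exp (- \<i> * of_real (k * (x - y))) * J x y i j)) \<and>
       (\<forall>j\<in>minus_cols mp mm.
          set_integrable lborel {..x} (\<lambda>y. exp (\<i> * of_real (k * (x - y))) * J x y i j) \<and>
          faddeev_N mp mm Q x k i j = idm i j +
            (LINT y:{..x}|lborel. exp (\<i> * of_real (k * (x - y))) * J x y i j))"
    if "i < ?n" for x k i
    using K'[THEN spec, THEN spec, THEN spec, THEN mp, OF that, of "- x" "- k"]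
    unfolding set_integral_atMost_reflect faddeev_N_eq_reflect[OF assms(3)] J_def minus_minus phase .
  have BJ: "set_integrable lborel {..x} (\<lambda>y. colnorm ?n Cs (J x y))"
    "(LINT y:{..x}|lborel. colnorm ?n Cs (J x y)) \<le> B'"
    if "Cs \<in> {plus_cols mp, minus_cols mp mm}" for x Cs
    using B'[rule_format, OF that, of "- x"]
    unfolding set_integral_atMost_reflect J_def minus_minus by blast+
  have BK: "set_integrable lborel {x..} (\<lambda>y. colnorm ?n Cs (K x y))"
    "(LINT y:{x..}|lborel. colnorm ?n Cs (K x y)) \<le> B"
    if "Cs \<in> {plus_cols mp, minus_cols mp mm}" for x Cs
    using B[rule_format, OF that, of x] by blast+
  note K1 = K[THEN spec, THEN spec, THEN spec, THEN mp, THEN conjunct1]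
    and K2 = K[THEN spec, THEN spec, THEN spec, THEN mp, THEN conjunct2]
  show ?thesis
  proof (rule exI[of _ K], rule exI[of _ J], intro conjI allI impI, goal_cases)
    case (1 x k i) thus ?case by (rule K1)
  next
    case (2 x k i) thus ?case by (rule K2)
  next
    case (3 x k i) thus ?case by (rule J[THEN conjunct1])
  next
    case (4 x k i) thus ?case by (rule J[THEN conjunct2])
  next
    case (5 x) show ?case by (rule BK) simp
  next
    case (6 x) show ?case by (rule BJ) simp
  next
    case (7 x) show ?case by (rule BK) simp
  next
    case (8 x) show ?case by (rule BJ) simp
  next
    case 9
    \<comment> \<open>One constant serves both column blocks, as \<open>B\<close> and
      \<open>B'\<close> each bound both of them.\<close>
    show ?case by (intro exI[of _ "B + B'"] allI conjI add_mono BK(2) BJ(2)) simp_all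
  qed
qed

end
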